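(* For every $N\ge0$, \[ y\,\bar Z_N=\sum_{H}\mathrm{wt}(H)\,\beta^{t_1(H)-1}\alpha^{t_2(H)}, \] where the sum is over all Laguerre histories $H$ of $N+1$ steps, $\mathrm{wt}(H)$ is the total weight of $H$, $t_1(H)$ is the number of type 1 steps of $H$, and $t_2(H)$ is the number of type 2 steps of $H$ lying to the right of every type 1 step of $H$.
   Context: Let $\mathcal A$ be the associative algebra over $\mathbb Z[y,q]$ generated by $D,E$ subject to $DE-qED=D+E$; every element is uniquely a finite $\mathbb Z[y,q]$-combination of words $E^iD^j$, and we write $(yD+E)^N=\sum_{i,j}c^{(N)}_{i,j}E^iD^j$. Define $\bar Z_N(\alpha,\beta,y,q)=\sum_{i,j}c^{(N)}_{i,j}\alpha^{i}\beta^{j}$ (the PASEP partition function with $\alpha,\beta$ replaced by $1/\alpha,1/\beta$). A Laguerre history of size $n$ is a Motzkin path of $n$ steps in which each step carries a weight: a step $\nearrow$ starting at height $h$ has weight $yq^i$ for some $i\in\{0,\dots,h\}$; a step $\rightarrow$ starting at height $h$ has weight either $yq^i$ for some $i\in\{0,\dots,h\}$ or $q^i$ for some $i\in\{0,\dots,h-1\}$; a step $\searrow$ starting at height $h$ has weight $q^i$ for some $i\in\{0,\dots,h-1\}$. Histories with the same path but different weight choices are distinct. Its total weight is the product of the weights of its steps. A type 1 step is a step with weight $yq^h$ and a type 2 step is a step with weight $q^{h-1}$, where $h$ is its starting height. *)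

theory Defs
  imports "HOL-Library.Poly_Mapping" "HOL-Computational_Algebra.Polynomial"
begin

section \<open>The coefficient ring \<open>\<int>[y,q]\<close>\<close>

type_synonym coeff_yq = "int poly poly"

definition var_y :: coeff_yq where "var_y = [:0, 1:]"

definition var_q :: coeff_yq where "var_q = [:[:0, 1:]:]"


section \<open>The algebra generated by \<open>D\<close>, \<open>E\<close> with \<open>DE - qED = D + E\<close>\<close>

datatype letter = Let_D | Let_E

datatype word = Word (letters: "letter list")

text \<open>Words form a monoid under concatenation, written additively since this is what
  the convolution product on \<^typ>\<open>'a \<Rightarrow>\<^sub>0 'b\<close> expects. Hence \<open>word \<Rightarrow>\<^sub>0 coeff_yq\<close> is the free
  associative algebra over \<open>\<int>[y,q]\<close> on the two letters.\<close>

instantiation word :: monoid_add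
begin

definition zero_word :: word where "zero_word = Word []"

definition plus_word :: "word \<Rightarrow> word \<Rightarrow> word" where
  "plus_word u v = Word (letters u @ letters v)"

instance
  by standard (simp_all add: zero_word_def plus_word_def)

end

type_synonym free_alg = "word \<Rightarrow>\<^sub>0 coeff_yq"

definition free_const :: "coeff_yq \<Rightarrow> free_alg" where
  "free_const c = Poly_Mapping.single 0 c"

definition free_D :: free_alg where "free_D = Poly_Mapping.single (Word [Let_D]) 1"

definition free_E :: free_alg where "free_E = Poly_Mapping.single (Word [Let_E]) 1"

definition relator :: free_alg where
  "relator = free_D * free_E - free_const var_q * free_E * free_D - (free_D + free_E)"

inductive_set relation_ideal :: "free_alg set" where
  zero: "0 \<in> relation_ideal"
| step: "x \<in> relation_ideal \<Longrightarrow> x + a * relator * b \<in> relation_ideal"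

lemma relation_ideal_add:
  "x \<in> relation_ideal \<Longrightarrow> y \<in> relation_ideal \<Longrightarrow> x + y \<in> relation_ideal"
proof (induction rule: relation_ideal.induct)
  case (step x a b)
  then show ?case
    using relation_ideal.step[of "x + y" a b] by (simp add: algebra_simps)
qed simp

lemma relation_ideal_mult_left: "x \<in> relation_ideal \<Longrightarrow> c * x \<in> relation_ideal"
proof (induction x rule: relation_ideal.induct)
  case (step x a b)
  then show ?case
    using relation_ideal.step[of "c * x" "c * a" b] by (simp add: algebra_simps)
qed (simp add: relation_ideal.zero)

lemma relation_ideal_mult_right: "x \<in> relation_ideal \<Longrightarrow> x * c \<in> relation_ideal"
proof (induction x rule: relation_ideal.induct)
  case (step x a b)
  then show ?case
    using relation_ideal.step[of "x * c" a "b * c"] by (simp add: algebra_simps)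
qed (simp add: relation_ideal.zero)

lemma relation_ideal_uminus: "x \<in> relation_ideal \<Longrightarrow> - x \<in> relation_ideal"
  using relation_ideal_mult_left[of x "- 1"] by simp

definition ideal_cong :: "free_alg \<Rightarrow> free_alg \<Rightarrow> bool" where
  "ideal_cong x y \<longleftrightarrow> x - y \<in> relation_ideal"

lemma equivp_ideal_cong: "equivp ideal_cong"
proof (rule equivpI)
  show "reflp ideal_cong"
    by (simp add: reflp_def ideal_cong_def relation_ideal.zero)
  show "symp ideal_cong"
  proof (rule sympI)
    fix x y assume "ideal_cong x y"
    then show "ideal_cong y x"
      using relation_ideal_uminus[of "x - y"] by (simp add: ideal_cong_def)
  qed
  show "transp ideal_cong"
  proof (rule transpI)
    fix x y z assume "ideal_cong x y" "ideal_cong y z"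
    then show "ideal_cong x z"
      using relation_ideal_add[of "x - y" "y - z"] by (simp add: ideal_cong_def)
  qed
qed

text \<open>The action of the free algebra on \<open>\<int>[y,q][D][E]\<close>, the coefficient of \<open>E^i D^j\<close> being
  \<open>coeff (coeff v i) j\<close>, factors through the relation \<open>DE - qED = D + E\<close>. It shows that the quotient
  is nontrivial and that normal forms are unique.\<close>

type_synonym nf_module = "coeff_yq poly poly"

definition act_E :: "nf_module \<Rightarrow> nf_module" where "act_E v = pCons 0 v"

primrec D_times :: "nat \<Rightarrow> coeff_yq poly \<Rightarrow> nf_module" where
  "D_times 0 p = [:pCons 0 p:]"
| "D_times (Suc i) p = smult [:var_q:] (act_E (D_times i p)) + D_times i p + monom p (Suc i)"

definition act_D :: "nf_module \<Rightarrow> nf_module" where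
  "act_D v = (\<Sum>i\<le>degree v. D_times i (coeff v i))"

lemma smult_sum_right: "smult c (sum f A) = (\<Sum>i\<in>A. smult c (f i))"
  by (induction A rule: infinite_finite_induct) (simp_all add: smult_add_right)

lemma act_E_add: "act_E (u + v) = act_E u + act_E v"
  by (simp add: act_E_def)

lemma act_E_smult: "act_E (smult c v) = smult c (act_E v)"
  by (simp add: act_E_def)

lemma D_times_0: "D_times i 0 = 0"
  by (induction i) (simp_all add: act_E_def)

lemma D_times_add: "D_times i (p + r) = D_times i p + D_times i r"
  by (induction i) (simp_all add: act_E_add smult_add_right add_monom[symmetric] algebra_simps)

lemma D_times_smult: "D_times i (smult c p) = smult [:c:] (D_times i p)"
  by (induction i) (simp_all add: act_E_smult smult_add_right smult_monom algebra_simps)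

lemma act_D_bound:
  assumes "degree v \<le> n"
  shows "act_D v = (\<Sum>i\<le>n. D_times i (coeff v i))"
  unfolding act_D_def using assms
  by (intro sum.mono_neutral_left) (auto simp: coeff_eq_0 D_times_0)

lemma act_D_add: "act_D (u + v) = act_D u + act_D v"
  using degree_add_le_max[of u v]
  by (simp add: act_D_bound[where n = "max (degree u) (degree v)"] D_times_add sum.distrib)

lemma act_D_smult: "act_D (smult [:c:] v) = smult [:c:] (act_D v)"
proof -
  have "act_D (smult [:c:] v) = (\<Sum>i\<le>degree v. D_times i (smult c (coeff v i)))"
    using degree_smult_le[of "[:c:]" v] by (simp add: act_D_bound[where n = "degree v"])
  then show ?thesis
    by (simp add: D_times_smult act_D_def smult_sum_right)
qed

lemma smult_act_E_sum: "smult c (act_E (sum f A)) = (\<Sum>i\<in>A. smult c (act_E (f i)))"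
  by (induction A rule: infinite_finite_induct) (simp_all add: act_E_add smult_add_right, simp_all add: act_E_def)

lemma act_D_E: "act_D (act_E v) = smult [:var_q:] (act_E (act_D v)) + act_D v + act_E v"
proof -
  have "act_D (act_E v) = (\<Sum>i\<le>Suc (degree v). D_times i (coeff (act_E v) i))"
    by (rule act_D_bound) (simp add: act_E_def)
  also have "\<dots> = (\<Sum>i\<le>degree v. D_times (Suc i) (coeff v i))"
    by (subst sum.atMost_Suc_shift) (simp add: act_E_def)
  also have "\<dots> = smult [:var_q:] (act_E (act_D v)) + act_D v
      + (\<Sum>i\<le>degree v. monom (coeff v i) (Suc i))"
    by (simp add: sum.distrib smult_act_E_sum act_D_def)
  also have "(\<Sum>i\<le>degree v. monom (coeff v i) (Suc i)) = act_E (\<Sum>i\<le>degree v. monom (coeff v i) i)"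
    using smult_act_E_sum[of 1 "\<lambda>i. monom (coeff v i) i" "{..degree v}"]
    by (simp add: monom_Suc act_E_def)
  finally show ?thesis
    by (simp add: poly_as_sum_of_monoms)
qed

fun act_letter :: "letter \<Rightarrow> nf_module \<Rightarrow> nf_module" where
  "act_letter Let_D = act_D"
| "act_letter Let_E = act_E"

definition act_word :: "word \<Rightarrow> nf_module \<Rightarrow> nf_module" where
  "act_word w = foldr act_letter (letters w)"

definition act :: "free_alg \<Rightarrow> nf_module \<Rightarrow> nf_module" where
  "act x v = (\<Sum>w\<in>Poly_Mapping.keys x. smult [:Poly_Mapping.lookup x w:] (act_word w v))"

lemma act_word_add: "act_word w (u + v) = act_word w u + act_word w v"
proof -
  have "act_letter l (u + v) = act_letter l u + act_letter l v" for l u v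
    by (cases l) (simp_all add: act_D_add act_E_add)
  then have "foldr act_letter ls (u + v) = foldr act_letter ls u + foldr act_letter ls v" for ls
    by (induction ls) simp_all
  then show ?thesis by (simp add: act_word_def)
qed

lemma act_word_smult: "act_word w (smult [:c:] v) = smult [:c:] (act_word w v)"
proof -
  have "act_letter l (smult [:c:] v) = smult [:c:] (act_letter l v)" for l v
    by (cases l) (simp_all add: act_D_smult act_E_smult)
  then have "foldr act_letter ls (smult [:c:] v) = smult [:c:] (foldr act_letter ls v)" for ls
    by (induction ls) simp_all
  then show ?thesis by (simp add: act_word_def)
qed

lemma act_word_plus: "act_word (u + w) v = act_word u (act_word w v)"
  by (simp add: act_word_def plus_word_def)

lemma act_superset:
  assumes "finite F" "Poly_Mapping.keys x \<subseteq> F"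
  shows "act x v = (\<Sum>w\<in>F. smult [:Poly_Mapping.lookup x w:] (act_word w v))"
  unfolding act_def using assms by (intro sum.mono_neutral_left) (auto simp: in_keys_iff)

lemma act_add: "act (x + y) v = act x v + act y v"
proof -
  let ?F = "Poly_Mapping.keys x \<union> Poly_Mapping.keys y"
  have "act (x + y) v = (\<Sum>w\<in>?F. smult [:Poly_Mapping.lookup (x + y) w:] (act_word w v))"
    by (rule act_superset) (use Poly_Mapping.keys_add[of x y] in auto)
  also have "\<dots> = (\<Sum>w\<in>?F. smult [:Poly_Mapping.lookup x w:] (act_word w v))
      + (\<Sum>w\<in>?F. smult [:Poly_Mapping.lookup y w:] (act_word w v))"
    by (simp add: lookup_add sum.distrib[symmetric] smult_add_left[symmetric])
  also have "\<dots> = act x v + act y v"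
    by (intro arg_cong2[where f = "(+)"] act_superset[symmetric]) auto
  finally show ?thesis .
qed

lemma act_single: "act (Poly_Mapping.single w c) v = smult [:c:] (act_word w v)"
  by (subst act_superset[where F = "{w}"]) auto

lemma act_0: "act 0 v = 0"
  by (simp add: act_def)

lemma act_uminus: "act (- x) v = - act x v"
  using act_add[of x "- x" v] by (simp add: act_0 eq_neg_iff_add_eq_0 add.commute)

lemma act_diff: "act (x - y) v = act x v - act y v"
  using act_add[of x "- y" v] by (simp add: act_uminus)

lemma free_alg_induct [case_names zero single add]:
  fixes x :: free_alg
  assumes "P 0" "\<And>w c. P (Poly_Mapping.single w c)" "\<And>x y. P x \<Longrightarrow> P y \<Longrightarrow> P (x + y)"
  shows "P x"
proof (induction x rule: Poly_Mapping.update_induct)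
  case const
  show ?case by (rule assms(1))
next
  case (update x w c)
  then have "Poly_Mapping.update w c x = x + Poly_Mapping.single w c"
    by (intro poly_mapping_eqI)
      (auto simp: lookup_add lookup_single lookup_update in_keys_iff when_def)
  then show ?case using update assms(2,3) by simp
qed

lemma act_vec_add: "act x (u + v) = act x u + act x v"
  by (simp add: act_def act_word_add smult_add_right sum.distrib)

lemma act_vec_smult: "act x (smult [:c:] v) = smult [:c:] (act x v)"
  by (simp add: act_def act_word_smult smult_sum_right mult.commute)

lemma act_times: "act (x * y) v = act x (act y v)"
proof (induction x rule: free_alg_induct)
  case (single w c)
  show ?case
  proof (induction y rule: free_alg_induct)
    case (single u d)
    show ?case by (simp add: mult_single act_single act_word_plus act_word_smult mult.commute)
  next
    case (add x y)
    then show ?case by (simp add: distrib_left act_add act_vec_add)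
  qed (simp add: act_0 act_single act_vec_smult[of _ 0, simplified])
next
  case (add x y)
  then show ?case by (simp add: distrib_right act_add)
qed (simp add: act_0)

lemma smult_one_poly: "smult [:1:] v = v" for v :: nf_module
  using smult_1_left[of v] by (simp only: one_pCons)

lemma act_relation_ideal: "x \<in> relation_ideal \<Longrightarrow> act x v = 0"
proof (induction x arbitrary: v rule: relation_ideal.induct)
  case zero
  show ?case by (rule act_0)
next
  case (step x a b)
  have "act relator u = 0" for u
    by (simp add: relator_def act_diff act_add act_times free_D_def free_E_def free_const_def
        act_single act_word_def zero_word_def plus_word_def smult_one_poly act_D_E)
  moreover have "act a 0 = 0"
    using act_vec_smult[of a 0 0] by simp
  ultimately show ?case
    using step by (simp add: act_add act_times)
qed

lemma act_1: "act 1 v = v"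
  by (simp add: single_one[symmetric] act_single act_word_def zero_word_def smult_one_poly del: single_one)

lemma one_not_in_relation_ideal: "1 \<notin> relation_ideal"
  using act_relation_ideal[of 1 1] by (auto simp: act_1)

quotient_type pasep_alg = free_alg / ideal_cong
  by (rule equivp_ideal_cong)

instantiation pasep_alg :: ring_1
begin

lift_definition zero_pasep_alg :: pasep_alg is 0 .

lift_definition one_pasep_alg :: pasep_alg is 1 .

lift_definition plus_pasep_alg :: "pasep_alg \<Rightarrow> pasep_alg \<Rightarrow> pasep_alg" is "(+)"
proof -
  fix x x' y y' assume "ideal_cong x x'" "ideal_cong y y'"
  then show "ideal_cong (x + y) (x' + y')"
    using relation_ideal_add[of "x - x'" "y - y'"] by (simp add: ideal_cong_def add_diff_add)
qed

lift_definition uminus_pasep_alg :: "pasep_alg \<Rightarrow> pasep_alg" is "uminus"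
proof -
  fix x x' assume "ideal_cong x x'"
  then show "ideal_cong (- x) (- x')"
    using relation_ideal_uminus[of "x - x'"] by (simp add: ideal_cong_def)
qed

lift_definition minus_pasep_alg :: "pasep_alg \<Rightarrow> pasep_alg \<Rightarrow> pasep_alg" is "(-)"
proof -
  fix x x' y y' assume "ideal_cong x x'" "ideal_cong y y'"
  then have "(x - x') + - (y - y') \<in> relation_ideal"
    unfolding ideal_cong_def by (intro relation_ideal_add relation_ideal_uminus)
  moreover have "(x - x') + - (y - y') = (x - y) - (x' - y')"
    by simp
  ultimately show "ideal_cong (x - y) (x' - y')"
    by (simp only: ideal_cong_def)
qed

lift_definition times_pasep_alg :: "pasep_alg \<Rightarrow> pasep_alg \<Rightarrow> pasep_alg" is "(*)"
proof -
  fix x x' y y' assume "ideal_cong x x'" "ideal_cong y y'"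
  then have "(x - x') * y + x' * (y - y') \<in> relation_ideal"
    by (intro relation_ideal_add relation_ideal_mult_left relation_ideal_mult_right)
      (simp_all add: ideal_cong_def)
  then show "ideal_cong (x * y) (x' * y')"
    by (simp add: ideal_cong_def algebra_simps)
qed

instance
proof
  fix a b c :: pasep_alg
  show "a * b * c = a * (b * c)" by transfer (simp add: ideal_cong_def mult.assoc relation_ideal.zero)
  show "1 * a = a" by transfer (simp add: ideal_cong_def relation_ideal.zero)
  show "a * 1 = a" by transfer (simp add: ideal_cong_def relation_ideal.zero)
  show "(a + b) * c = a * c + b * c"
    by transfer (simp add: ideal_cong_def distrib_right relation_ideal.zero)
  show "a * (b + c) = a * b + a * c"
    by transfer (simp add: ideal_cong_def distrib_left relation_ideal.zero)
  show "a + b + c = a + (b + c)"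
    by transfer (simp add: ideal_cong_def add.assoc relation_ideal.zero)
  show "a + b = b + a"
    by transfer (simp add: ideal_cong_def add.commute relation_ideal.zero)
  show "0 + a = a" by transfer (simp add: ideal_cong_def relation_ideal.zero)
  show "- a + a = 0" by transfer (simp add: ideal_cong_def relation_ideal.zero)
  show "a - b = a + - b" by transfer (simp add: ideal_cong_def relation_ideal.zero)
  show "(0 :: pasep_alg) \<noteq> 1"
  proof transfer
    show "\<not> ideal_cong 0 1"
      using one_not_in_relation_ideal relation_ideal_uminus[of "- 1"] by (auto simp: ideal_cong_def)
  qed
qed

end

lift_definition alg_const :: "coeff_yq \<Rightarrow> pasep_alg" is free_const .

lift_definition alg_D :: pasep_alg is free_D .

lift_definition alg_E :: pasep_alg is free_E .

lemma alg_relation: "alg_D * alg_E - alg_const var_q * alg_E * alg_D = alg_D + alg_E"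
proof -
  have "ideal_cong (free_D * free_E - free_const var_q * free_E * free_D) (free_D + free_E)"
    using relation_ideal.step[OF relation_ideal.zero, of 1 1]
    by (simp add: ideal_cong_def relator_def)
  then show ?thesis
    by (simp add: alg_const.abs_eq alg_D.abs_eq alg_E.abs_eq times_pasep_alg.abs_eq
        minus_pasep_alg.abs_eq plus_pasep_alg.abs_eq pasep_alg.abs_eq_iff)
qed

text \<open>\<open>c i j\<close> is the coefficient of \<open>E^i D^j\<close>.\<close>

definition normal_form :: "pasep_alg \<Rightarrow> (nat \<Rightarrow> nat \<Rightarrow> coeff_yq) \<Rightarrow> bool" where
  "normal_form x c \<longleftrightarrow> finite {(i, j). c i j \<noteq> 0} \<and>
     x = (\<Sum>(i, j) | c i j \<noteq> 0. alg_const (c i j) * alg_E ^ i * alg_D ^ j)"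

definition nf_coeff :: "pasep_alg \<Rightarrow> nat \<Rightarrow> nat \<Rightarrow> coeff_yq" where
  "nf_coeff x = (THE c. normal_form x c)"

lift_definition act_alg :: "pasep_alg \<Rightarrow> nf_module \<Rightarrow> nf_module" is act
proof (rule ext)
  fix x y :: free_alg and v assume "ideal_cong x y"
  then show "act x v = act y v"
    using act_relation_ideal[of "x - y" v] by (simp add: ideal_cong_def act_diff)
qed

lemma act_alg_add: "act_alg (a + b) v = act_alg a v + act_alg b v"
  by transfer (rule act_add)

lemma act_alg_times: "act_alg (a * b) v = act_alg a (act_alg b v)"
  by transfer (rule act_times)

lemma act_alg_0: "act_alg 0 v = 0"
  by transfer (rule act_0)

lemma act_alg_1: "act_alg 1 v = v"
  by transfer (rule act_1)

lemma act_alg_const: "act_alg (alg_const c) v = smult [:c:] v"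
  by transfer (simp add: free_const_def act_single act_word_def zero_word_def)

lemma act_alg_D: "act_alg alg_D v = act_D v"
  by transfer (simp add: free_D_def act_single act_word_def smult_one_poly)

lemma act_alg_E: "act_alg alg_E v = act_E v"
  by transfer (simp add: free_E_def act_single act_word_def smult_one_poly)

lemma act_alg_sum: "act_alg (sum f A) v = (\<Sum>i\<in>A. act_alg (f i) v)"
  by (induction A rule: infinite_finite_induct) (simp_all add: act_alg_0 act_alg_add)

lemma act_alg_monomial:
  "act_alg (alg_const c * alg_E ^ i * alg_D ^ j) 1 = monom (monom c j) i"
proof -
  have "act_alg (alg_D ^ j) 1 = [:monom 1 j:]"
    by (induction j) (simp_all add: act_alg_1 act_alg_times act_alg_D act_D_def monom_Suc)
  moreover have "act_alg (alg_E ^ i) [:p:] = monom p i" for p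
    by (induction i) (simp_all add: act_alg_1 act_alg_times act_alg_E act_E_def monom_Suc monom_0)
  ultimately show ?thesis
    by (simp add: act_alg_times act_alg_const smult_monom)
qed

lemma normal_form_coeff:
  assumes "normal_form x c"
  shows "c i j = coeff (coeff (act_alg x 1) i) j"
proof -
  let ?S = "{(i, j). c i j \<noteq> 0}"
  have "coeff (coeff (act_alg x 1) i) j
      = (\<Sum>p\<in>?S. coeff (coeff (act_alg (case p of (k, l) \<Rightarrow>
            alg_const (c k l) * alg_E ^ k * alg_D ^ l) 1) i) j)"
    using assms unfolding normal_form_def by (simp add: act_alg_sum coeff_sum)
  also have "\<dots> = (\<Sum>p\<in>?S. if p = (i, j) then c i j else 0)"
    by (intro sum.cong) (auto simp: act_alg_monomial coeff_monom split: if_splits)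
  also have "\<dots> = c i j"
    using assms by (simp add: normal_form_def)
  finally show ?thesis ..
qed

inductive_set nf_span :: "pasep_alg set" where
  zero: "0 \<in> nf_span"
| step: "x \<in> nf_span \<Longrightarrow> alg_const c * alg_E ^ i * alg_D ^ j + x \<in> nf_span"

lemma nf_span_monomial: "alg_const c * alg_E ^ i * alg_D ^ j \<in> nf_span"
  using nf_span.step[OF nf_span.zero] by simp

lemma nf_span_add: "x \<in> nf_span \<Longrightarrow> y \<in> nf_span \<Longrightarrow> x + y \<in> nf_span"
proof (induction rule: nf_span.induct)
  case (step x c i j)
  then show ?case
    using nf_span.step[of "x + y" c i j] by (simp only: add.assoc)
qed simp

lemma alg_const_mult: "alg_const (c * d) = alg_const c * alg_const d"
  by (simp add: alg_const.abs_eq times_pasep_alg.abs_eq free_const_def mult_single)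

lemma alg_const_add: "alg_const (c + d) = alg_const c + alg_const d"
  by (simp add: alg_const.abs_eq plus_pasep_alg.abs_eq free_const_def single_add)

lemma alg_const_0: "alg_const 0 = 0"
  by (simp add: alg_const.abs_eq zero_pasep_alg_def free_const_def)

lemma alg_const_1: "alg_const 1 = 1"
  by (simp add: alg_const.abs_eq one_pasep_alg_def free_const_def)

lemma alg_const_E: "alg_E * alg_const c = alg_const c * alg_E"
  by (simp add: alg_const.abs_eq alg_E.abs_eq times_pasep_alg.abs_eq free_const_def free_E_def
      mult_single)

lemma alg_const_D: "alg_D * alg_const c = alg_const c * alg_D"
  by (simp add: alg_const.abs_eq alg_D.abs_eq times_pasep_alg.abs_eq free_const_def free_D_def
      mult_single)

lemma nf_span_const: "x \<in> nf_span \<Longrightarrow> alg_const d * x \<in> nf_span"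
proof (induction rule: nf_span.induct)
  case (step x c i j)
  then show ?case
    using nf_span.step[of "alg_const d * x" "d * c" i j]
    by (simp add: distrib_left alg_const_mult mult.assoc)
qed (simp add: nf_span.zero)

lemma nf_span_E: "x \<in> nf_span \<Longrightarrow> alg_E * x \<in> nf_span"
proof (induction rule: nf_span.induct)
  case (step x c i j)
  have "alg_E * (alg_const c * alg_E ^ i * alg_D ^ j) = alg_const c * alg_E ^ Suc i * alg_D ^ j"
    by (simp only: mult.assoc[symmetric] alg_const_E power_Suc)
  then show ?case
    using nf_span.step[OF step.IH, of c "Suc i" j] by (simp add: distrib_left)
qed (simp add: nf_span.zero)

lemma nf_span_D_monomial: "alg_D * (alg_E ^ i * alg_D ^ j) \<in> nf_span"
proof (induction i)
  case 0
  show ?case using nf_span_monomial[of 1 0 "Suc j"] by (simp add: alg_const_1)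
next
  case (Suc i)
  let ?m = "alg_E ^ i * alg_D ^ j"
  have "alg_D * alg_E = alg_const var_q * alg_E * alg_D + (alg_D + alg_E)"
    using alg_relation by (simp add: algebra_simps)
  then have "alg_D * (alg_E * ?m) = (alg_const var_q * alg_E * alg_D + (alg_D + alg_E)) * ?m"
    by (simp only: mult.assoc[symmetric])
  also have "\<dots> = alg_const var_q * (alg_E * (alg_D * ?m)) + (alg_D * ?m + alg_E * ?m)"
    by (simp only: distrib_right mult.assoc)
  also have "\<dots> \<in> nf_span"
    using Suc nf_span_monomial[of 1 i j]
    by (intro nf_span_add nf_span_const nf_span_E) (simp_all add: alg_const_1)
  finally show ?case by (simp add: mult.assoc)
qed

lemma nf_span_D: "x \<in> nf_span \<Longrightarrow> alg_D * x \<in> nf_span"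
proof (induction rule: nf_span.induct)
  case (step x c i j)
  have "alg_D * (alg_const c * alg_E ^ i * alg_D ^ j) = alg_const c * (alg_D * (alg_E ^ i * alg_D ^ j))"
    by (simp only: mult.assoc[symmetric] alg_const_D)
  then show ?case
    using step.IH nf_span_add nf_span_const nf_span_D_monomial by (simp add: distrib_left)
qed (simp add: nf_span.zero)

lemma nf_span_UNIV: "x \<in> nf_span"
proof -
  have hom: "abs_pasep_alg (f + g) = abs_pasep_alg f + abs_pasep_alg g" for f g
    by (rule plus_pasep_alg.abs_eq[symmetric])
  have "abs_pasep_alg f \<in> nf_span" for f
  proof (induction f rule: free_alg_induct)
    case zero
    have "abs_pasep_alg 0 = 0"
      by (rule zero_pasep_alg.abs_eq[symmetric])
    then show ?case by (simp add: nf_span.zero)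
  next
    case (single w c)
    have "abs_pasep_alg (Poly_Mapping.single (Word ls) 1) \<in> nf_span" for ls
    proof (induction ls)
      case Nil
      have "abs_pasep_alg (Poly_Mapping.single (Word []) 1) = alg_const 1"
        by (simp add: alg_const.abs_eq free_const_def zero_word_def)
      then show ?case using nf_span_monomial[of 1 0 0] by simp
    next
      case (Cons l ls)
      have "abs_pasep_alg (Poly_Mapping.single (Word (l # ls)) 1)
          = (case l of Let_D \<Rightarrow> alg_D | Let_E \<Rightarrow> alg_E) * abs_pasep_alg (Poly_Mapping.single (Word ls) 1)"
        by (cases l)
          (simp_all add: alg_D.abs_eq alg_E.abs_eq times_pasep_alg.abs_eq free_D_def free_E_def
            mult_single plus_word_def)
      then show ?case
        using Cons nf_span_D nf_span_E by (cases l) simp_all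
    qed
    from this[of "letters w"] have "abs_pasep_alg (Poly_Mapping.single w 1) \<in> nf_span"
      by simp
    moreover have "abs_pasep_alg (Poly_Mapping.single w c)
        = alg_const c * abs_pasep_alg (Poly_Mapping.single w 1)"
      by (simp add: alg_const.abs_eq times_pasep_alg.abs_eq free_const_def mult_single)
    ultimately show ?case by (simp add: nf_span_const)
  next
    case (add f g)
    then show ?case by (simp add: hom nf_span_add)
  qed
  moreover have "\<exists>f. x = abs_pasep_alg f"
    by (induction x rule: pasep_alg.abs_induct) blast
  ultimately show ?thesis by auto
qed

lemma ex1_normal_form: "\<exists>!c. normal_form x c"
proof (rule ex_ex1I)
  let ?m = "\<lambda>c (i, j). alg_const (c i j) * alg_E ^ i * alg_D ^ j"
  have superset: "(\<Sum>p | (case p of (i, j) \<Rightarrow> c i j \<noteq> 0). ?m c p) = (\<Sum>p\<in>F. ?m c p)"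
    if "finite F" "{(i, j). c i j \<noteq> 0} \<subseteq> F" for c F
    using that by (intro sum.mono_neutral_left) (auto simp: alg_const_0)
  show "\<exists>c. normal_form x c"
    using nf_span_UNIV[of x]
  proof (induction rule: nf_span.induct)
    case zero
    have "normal_form 0 (\<lambda>_ _. 0)" by (simp add: normal_form_def)
    then show ?case by blast
  next
    case (step x d k l)
    then obtain c where c: "normal_form x c" by blast
    define c' where "c' i j = c i j + (if (i, j) = (k, l) then d else 0)" for i j
    define F where "F = insert (k, l) {(i, j). c i j \<noteq> 0}"
    have fin: "finite F" using c by (simp add: F_def normal_form_def)
    have subc: "{(i, j). c i j \<noteq> 0} \<subseteq> F" by (auto simp: F_def)
    have sub: "{(i, j). c' i j \<noteq> 0} \<subseteq> F" by (auto simp: F_def c'_def split: if_splits)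
    have "(\<Sum>p\<in>F. ?m c' p) = (\<Sum>p\<in>F. ?m c p
        + (if p = (k, l) then alg_const d * alg_E ^ k * alg_D ^ l else 0))"
      by (intro sum.cong) (auto simp: c'_def alg_const_add alg_const_0 distrib_right split: if_splits)
    also have "\<dots> = (\<Sum>p\<in>F. ?m c p) + alg_const d * alg_E ^ k * alg_D ^ l"
      using fin by (simp add: sum.distrib F_def)
    also have "(\<Sum>p\<in>F. ?m c p) = x"
      using c superset[OF fin subc] by (simp add: normal_form_def)
    finally have "normal_form (alg_const d * alg_E ^ k * alg_D ^ l + x) c'"
      using superset[OF fin sub] finite_subset[OF sub fin]
      by (simp add: normal_form_def add.commute)
    then show ?case by blast
  qed
next
  fix c d assume "normal_form x c" "normal_form x d"
  then show "c = d" by (intro ext) (simp add: normal_form_coeff)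
qed


section \<open>The partition function\<close>

text \<open>The polynomial ring \<open>\<int>[y,q,\<alpha>,\<beta>]\<close>, represented as \<open>\<int>[y,q][\<beta>][\<alpha>]\<close>.\<close>

type_synonym poly_yqab = "coeff_yq poly poly"

definition poly_const :: "coeff_yq \<Rightarrow> poly_yqab" where "poly_const c = [:[:c:]:]"

definition var_alpha :: poly_yqab where "var_alpha = [:0, 1:]"

definition var_beta :: poly_yqab where "var_beta = [:[:0, 1:]:]"

definition Zbar :: "nat \<Rightarrow> poly_yqab" where
  "Zbar N = (let c = nf_coeff ((alg_const var_y * alg_D + alg_E) ^ N) in
     \<Sum>(i, j) | c i j \<noteq> 0. poly_const (c i j) * var_alpha ^ i * var_beta ^ j)"


section \<open>Laguerre histories\<close>

datatype direction = Up | Level | Down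

text \<open>A history lists its steps from left to right, each with its direction and its weight.\<close>

type_synonym history = "(direction \<times> coeff_yq) list"

fun rise :: "direction \<Rightarrow> int" where
  "rise Up = 1"
| "rise Level = 0"
| "rise Down = - 1"

text \<open>The height at which step \<open>k\<close> (counted from \<open>0\<close>) starts:\<close>

definition height :: "history \<Rightarrow> nat \<Rightarrow> int" where
  "height H k = (\<Sum>i<k. rise (fst (H ! i)))"

definition motzkin_path :: "history \<Rightarrow> bool" where
  "motzkin_path H \<longleftrightarrow> (\<forall>k\<le>length H. 0 \<le> height H k) \<and> height H (length H) = 0"

fun step_weights :: "direction \<Rightarrow> nat \<Rightarrow> coeff_yq set" where
  "step_weights Up h = {var_y * var_q ^ i | i. i \<le> h}"
| "step_weights Level h = {var_y * var_q ^ i | i. i \<le> h} \<union> {var_q ^ i | i. i < h}"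
| "step_weights Down h = {var_q ^ i | i. i < h}"

definition laguerre_histories :: "nat \<Rightarrow> history set" where
  "laguerre_histories n = {H. length H = n \<and> motzkin_path H \<and>
     (\<forall>k<n. snd (H ! k) \<in> step_weights (fst (H ! k)) (nat (height H k)))}"

definition total_weight :: "history \<Rightarrow> coeff_yq" where
  "total_weight H = (\<Prod>k<length H. snd (H ! k))"

definition type1_steps :: "history \<Rightarrow> nat set" where
  "type1_steps H = {k. k < length H \<and> snd (H ! k) = var_y * var_q ^ nat (height H k)}"

definition type2_steps :: "history \<Rightarrow> nat set" where
  "type2_steps H = {k. k < length H \<and> 1 \<le> height H k \<and> snd (H ! k) = var_q ^ nat (height H k - 1)}"

definition t1 :: "history \<Rightarrow> nat" where
  "t1 H = card (type1_steps H)"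

definition t2 :: "history \<Rightarrow> nat" where
  "t2 H = card {k \<in> type2_steps H. \<forall>l\<in>type1_steps H. l < k}"

lemma finite_laguerre_histories: "finite (laguerre_histories n)"
proof -
  let ?W = "\<Union>h\<le>n. \<Union>d\<in>{Up, Level, Down}. {d} \<times> step_weights d h"
  have "finite (step_weights d h)" for d h
    by (cases d) (simp_all add: finite_image_set)
  then have "finite {H. set H \<subseteq> ?W \<and> length H = n}"
    by (intro finite_lists_length_eq) auto
  moreover have "laguerre_histories n \<subseteq> {H. set H \<subseteq> ?W \<and> length H = n}"
  proof
    fix H assume H: "H \<in> laguerre_histories n"
    have "s \<in> ?W" if "s \<in> set H" for s
    proof -
      obtain k where k: "k < length H" "H ! k = s"
        using \<open>s \<in> set H\<close> by (auto simp: in_set_conv_nth)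
      have "height H k \<le> (\<Sum>i<k. 1)"
        unfolding height_def
      proof (rule sum_mono)
        fix i show "rise (fst (H ! i)) \<le> 1" by (cases "fst (H ! i)") simp_all
      qed
      then have "nat (height H k) \<le> n"
        using k H by (simp add: laguerre_histories_def)
      moreover have "snd s \<in> step_weights (fst s) (nat (height H k))"
        using H k by (auto simp: laguerre_histories_def)
      moreover have "fst s \<in> {Up, Level, Down}"
        by (cases "fst s") simp_all
      ultimately show ?thesis
        by (intro UN_I[of "nat (height H k)"] UN_I[of "fst s"]) (auto simp: mem_Times_iff)
    qed
    then show "H \<in> {H. set H \<subseteq> ?W \<and> length H = n}"
      using H by (auto simp only: laguerre_histories_def)
  qed
  ultimately show ?thesis by (rule finite_subset[rotated])
qed

text \<open>The first step starts at height \<open>0\<close> and so is of type 1. Thus the exponent \<open>t1 H - 1\<close> never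
  involves truncated subtraction for a nonempty history.\<close>

lemma t1_pos:
  assumes "H \<in> laguerre_histories (Suc n)"
  shows "0 < t1 H"
proof -
  have w: "snd (H ! 0) \<in> step_weights (fst (H ! 0)) 0" and len: "0 < length H"
    using assms by (auto simp: laguerre_histories_def height_def)
  have "0 \<in> type1_steps H"
    using w len by (cases "fst (H ! 0)") (auto simp: type1_steps_def height_def)
  moreover have "finite (type1_steps H)"
    by (simp add: type1_steps_def)
  ultimately show ?thesis
    by (auto simp: t1_def card_gt_0_iff)
qed

end

theory Submission
  imports Defs "HOL-Library.Function_Algebras"
begin

text \<open>
  Write \<open>[n] = 1 + q + \<dots> + q^(n-1)\<close>. On functions \<open>f\<close> of the height, the transfer operators
  \<open>D f h = ([h] + \<beta> q^h) (f h + f (h+1))\<close> and \<open>E f h = [h] (f h + f (h-1))\<close> satisfy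
  \<open>DE - qED = D + E\<close>, and the indicator function \<open>e\<close> of \<open>0\<close> is an eigenvector of \<open>D\<close> for \<open>\<beta>\<close>.
  The functional \<open>f \<mapsto> \<Sum>j. f j c_j\<close> with \<open>c_j = (\<Prod>i<j. \<alpha> - [i]) / [j]!\<close> is a left eigenvector
  of \<open>E\<close> for \<open>\<alpha>\<close>, so it maps \<open>M^N e\<close>, where \<open>M = yD + E\<close>, to the partition function.

  Cut a history before its last type 1 step. The part to the left of the cut is counted by \<open>M\<close>; the weights
  of the part to its right are polynomials in \<open>\<alpha>\<close>. Expanded in the \<open>c_j\<close> they give arrays indexed
  by the height and by \<open>j\<close>. Let \<open>y K_n\<close> be the array of the parts that consist of a type 1 step and
  \<open>n\<close> further steps, and \<open>U_n\<close> that of the paths of \<open>n\<close> steps with a type 1 step, so that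
  \<open>U_(n+1) = M_x U_n + y K_n\<close>, where \<open>M_x\<close> and \<open>M_a\<close> are \<open>M\<close> acting on the first and on the second index.
  The point is that \<open>K_(n+1) - M_a K_n\<close> is a symmetric array. By induction this gives
  \<open>(M_x - M_a) U_n = y (K_n\<^sup>T - K_n)\<close>, that is, \<open>U_(n+1) = M_a U_n + y K_n\<^sup>T\<close>. For \<open>n > 0\<close> the row of
  \<open>K_n\<^sup>T\<close> at height \<open>0\<close> vanishes, because without type 1 steps a path can only come down from height \<open>1\<close> by a
  type 2 step. Hence the row of \<open>U_(N+1)\<close> at height \<open>0\<close> is \<open>y M^N e\<close>.

  The symmetry comes from two operators \<open>L\<close> for which the commutator of \<open>L\<close> and its conjugate \<open>L'\<close> under
  transposition is a left multiple of \<open>L' - L\<close>: if \<open>f\<close> and \<open>L f\<close> are symmetric, so is \<open>L (L f)\<close>.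
\<close>

section \<open>Operators on arrays\<close>

definition q_bracket :: "'a::comm_ring_1 \<Rightarrow> nat \<Rightarrow> 'a" where
  "q_bracket q n = (\<Sum>i<n. q ^ i)"

lemma q_bracket_0 [simp]: "q_bracket q 0 = 0"
  by (simp add: q_bracket_def)

lemma q_bracket_Suc: "q_bracket q (Suc n) = q_bracket q n + q ^ n"
  by (simp add: q_bracket_def)

lemma q_bracket_Suc': "q_bracket q (Suc n) = 1 + q * q_bracket q n"
  by (simp only: q_bracket_def sum.lessThan_Suc_shift) (simp add: sum_distrib_left)

lemma q_power_bracket: "q ^ n = 1 - (1 - q) * q_bracket q n"
  using q_bracket_Suc[of q n] q_bracket_Suc'[of q n] by (simp add: algebra_simps)

type_synonym 'a array = "nat \<Rightarrow> nat \<Rightarrow> 'a"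

definition transp_array :: "'a array \<Rightarrow> 'a array" where
  "transp_array f h j = f j h"

definition scale :: "'a::times \<Rightarrow> 'a array \<Rightarrow> 'a array" where
  "scale c f h j = c * f h j"

primrec shift :: "(nat \<Rightarrow> 'a::zero) \<Rightarrow> nat \<Rightarrow> 'a" where
  "shift f 0 = 0"
| "shift f (Suc n) = f n"

section \<open>Operators on arrays and their commutation rules\<close>

locale laguerre_operators =
  fixes q :: "'a::idom"
begin

abbreviation bracket :: "nat \<Rightarrow> 'a" (\<open>[_]\<^sub>q\<close>) where "[n]\<^sub>q \<equiv> q_bracket q n"

definition opE :: "(nat \<Rightarrow> 'a) \<Rightarrow> nat \<Rightarrow> 'a" where
  "opE f j = [j]\<^sub>q * (f j + shift f j)"

definition opG :: "(nat \<Rightarrow> 'a) \<Rightarrow> nat \<Rightarrow> 'a" where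
  "opG f j = q ^ j * (f j + shift f j)"

text \<open>The suffix \<open>x\<close> marks the action on the first index (the height), the suffix \<open>a\<close> the action on the
  second one (the coordinate of a polynomial in \<open>\<alpha>\<close>).\<close>

definition Ex :: "'a array \<Rightarrow> 'a array" where "Ex f h j = opE (\<lambda>i. f i j) h"
definition Gx :: "'a array \<Rightarrow> 'a array" where "Gx f h j = opG (\<lambda>i. f i j) h"
definition Sx :: "'a array \<Rightarrow> 'a array" where "Sx f h j = shift (\<lambda>i. f i j) h"
definition Ea :: "'a array \<Rightarrow> 'a array" where "Ea f h j = opE (f h) j"
definition Ga :: "'a array \<Rightarrow> 'a array" where "Ga f h j = opG (f h) j"
definition Sa :: "'a array \<Rightarrow> 'a array" where "Sa f h j = shift (f h) j"

lemmas op_defs = Ex_def Gx_def Sx_def Ea_def Ga_def Sa_def opE_def opG_def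

lemma op_add:
  "Ex (f + g) = Ex f + Ex g" "Gx (f + g) = Gx f + Gx g" "Sx (f + g) = Sx f + Sx g"
  "Ea (f + g) = Ea f + Ea g" "Ga (f + g) = Ga f + Ga g" "Sa (f + g) = Sa f + Sa g"
  "transp_array (f + g) = transp_array f + transp_array g"
  by (rule ext, rule ext, rename_tac h j, case_tac h; case_tac j;
      simp add: op_defs transp_array_def algebra_simps)+

lemma op_diff:
  "Ex (f - g) = Ex f - Ex g" "Gx (f - g) = Gx f - Gx g" "Sx (f - g) = Sx f - Sx g"
  "Ea (f - g) = Ea f - Ea g" "Ga (f - g) = Ga f - Ga g" "Sa (f - g) = Sa f - Sa g"
  "transp_array (f - g) = transp_array f - transp_array g"
  by (rule ext, rule ext, rename_tac h j, case_tac h; case_tac j;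
      simp add: op_defs transp_array_def algebra_simps)+

lemma op_scale:
  "Ex (scale c f) = scale c (Ex f)" "Gx (scale c f) = scale c (Gx f)" "Sx (scale c f) = scale c (Sx f)"
  "Ea (scale c f) = scale c (Ea f)" "Ga (scale c f) = scale c (Ga f)" "Sa (scale c f) = scale c (Sa f)"
  "transp_array (scale c f) = scale c (transp_array f)"
  by (rule ext, rule ext, rename_tac h j, case_tac h; case_tac j;
      simp add: op_defs scale_def transp_array_def algebra_simps)+

lemma scale_add: "scale c (f + g) = scale c f + scale c (g :: 'a array)"
  "scale c (f - g) = scale c f - scale c (g :: 'a array)"
  "scale c (scale d f) = scale (c * d) f"
  by (rule ext, rule ext, simp add: scale_def algebra_simps)+

lemma transp_array_op:
  "transp_array (Ex f) = Ea (transp_array f)" "transp_array (Ea f) = Ex (transp_array f)"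
  "transp_array (Gx f) = Ga (transp_array f)" "transp_array (Ga f) = Gx (transp_array f)"
  "transp_array (Sx f) = Sa (transp_array f)" "transp_array (Sa f) = Sx (transp_array f)"
  "transp_array (transp_array f) = f"
  by (rule ext, rule ext, simp add: transp_array_def[abs_def] op_defs)+

lemma op_commute:
  "Ea (Ex f) = Ex (Ea f)" "Ea (Gx f) = Gx (Ea f)" "Ea (Sx f) = Sx (Ea f)"
  "Ga (Ex f) = Ex (Ga f)" "Ga (Gx f) = Gx (Ga f)" "Ga (Sx f) = Sx (Ga f)"
  "Sa (Ex f) = Ex (Sa f)" "Sa (Gx f) = Gx (Sa f)" "Sa (Sx f) = Sx (Sa f)"
  by (rule ext, rule ext, rename_tac h j, case_tac h; case_tac j; simp add: op_defs algebra_simps)+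

lemma opE_shift: "opE (shift f) n = shift (opE f) n + shift (opG f) n"
  by (cases n) (simp_all add: opE_def opG_def q_bracket_Suc algebra_simps)

lemma opG_opE: "opG (opE f) n = opE (opG f) n - shift (opG f) n"
  by (cases n) (simp_all add: opE_def opG_def q_bracket_Suc' q_power_bracket algebra_simps)

lemma opG_shift: "opG (shift f) n = q * shift (opG f) n"
  by (cases n) (simp_all add: opG_def algebra_simps)

text \<open>Oriented to move \<open>S\<close> to the left of \<open>E\<close>, and both to the left
  of \<open>G\<close>. With \<open>op_commute\<close>, which separates the two indices, this makes
  operator words comparable.\<close>

lemma op_relations:
  "Ex (Sx f) = Sx (Ex f) + Sx (Gx f)" "Ea (Sa f) = Sa (Ea f) + Sa (Ga f)"
  "Gx (Ex f) = Ex (Gx f) - Sx (Gx f)" "Ga (Ea f) = Ea (Ga f) - Sa (Ga f)"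
  "Gx (Sx f) = scale q (Sx (Gx f))" "Ga (Sa f) = scale q (Sa (Ga f))"
  using opE_shift opG_opE opG_shift
  by (auto intro!: ext simp: Ex_def[abs_def] Gx_def[abs_def] Sx_def[abs_def] Ea_def[abs_def] Ga_def[abs_def]
       Sa_def[abs_def] scale_def)

lemma opG_eq: "opG f n = f n + shift f n - (1 - q) * opE f n"
  by (simp add: opE_def opG_def q_power_bracket algebra_simps)

lemma Gx_eq: "Gx f = f + Sx f - scale (1 - q) (Ex f)" and Ga_eq: "Ga f = f + Sa f - scale (1 - q) (Ea f)"
  by (auto intro!: ext simp: Gx_def Sx_def Ex_def Ga_def Sa_def Ea_def opG_eq scale_def)

text \<open>\<open>Lam\<close> is, after conjugation by \<open>opF\<close> on the first index, the part without factor \<open>y\<close> of the transfer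
  operator to the right of the last type 1 step: in coordinates, multiplication by \<open>\<alpha>\<close> is \<open>Ea\<close>. Conjugating
  once more, by \<open>Fa\<close> on the second index, turns \<open>Lam\<close> into \<open>1 + q Lam'\<close>.\<close>

definition Lam :: "'a array \<Rightarrow> 'a array" where
  "Lam f = Ex f - Sx f + Gx (Ea f)"

definition Lam' :: "'a array \<Rightarrow> 'a array" where
  "Lam' f = Ex f + Gx (Ea f)"

definition conj_transp :: "('a array \<Rightarrow> 'a array) \<Rightarrow> 'a array \<Rightarrow> 'a array" where
  "conj_transp L f = transp_array (L (transp_array f))"

lemma Lam_commutator:
  "scale q (Lam (conj_transp Lam f) - conj_transp Lam (Lam f)) = Gx (Ga (conj_transp Lam f - Lam f))"
proof -
  \<comment> \<open>Once \<open>G\<close> is eliminated by \<open>Gx_eq\<close> and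
    \<open>Ga_eq\<close>, the terms with \<open>Ex (Ea f)\<close> cancel.\<close>
  have "conj_transp Lam f - Lam f = Sx f - Sa f - Sx (Ea f) + Ex (Sa f)"
    unfolding conj_transp_def Lam_def
    by (simp add: op_add op_diff transp_array_op op_commute)
      (simp add: Gx_eq Ga_eq, simp add: op_add op_diff op_scale scale_add op_commute)
  moreover have "Lam (conj_transp Lam f) - conj_transp Lam (Lam f)
    = Sx (Gx (Ga f)) - Gx (Sa (Ga f)) - Sx (Gx (Ea (Ga f))) + Ex (Gx (Sa (Ga f)))"
    unfolding conj_transp_def Lam_def
    by (simp add: op_add op_diff transp_array_op op_commute op_relations)
  ultimately show ?thesis 
    by (simp add: op_add op_diff op_scale scale_add op_commute op_relations)
qed

lemma Lam'_commutator:
  "scale q (Lam' (conj_transp Lam' f) - conj_transp Lam' (Lam' f)) = Gx (Ga (conj_transp Lam' f - Lam' f))"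
proof -
  have "conj_transp Lam' f - Lam' f = Ex (Sa f) - Sx (Ea f)"
    unfolding conj_transp_def Lam'_def
    by (simp add: op_add op_diff transp_array_op op_commute)
      (simp add: Gx_eq Ga_eq, simp add: op_add op_diff op_scale scale_add op_commute)
  moreover have "Lam' (conj_transp Lam' f) - conj_transp Lam' (Lam' f)
    = Ex (Gx (Sa (Ga f))) - Sx (Gx (Ea (Ga f)))"
    unfolding conj_transp_def Lam'_def
    by (simp add: op_add op_diff transp_array_op op_commute op_relations)
  ultimately show ?thesis 
    by (simp add: op_add op_diff op_scale scale_add op_commute op_relations)
qed

definition symm :: "'a array \<Rightarrow> bool" where "symm f \<longleftrightarrow> transp_array f = f"

lemma op_zero: "Gx 0 = 0" "Ga 0 = 0"
  using op_diff[of 0 0] by simp_all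

text \<open>Symmetry of \<open>f\<close> and \<open>L f\<close> makes \<open>conj_transp L f\<close>
  equal to \<open>L f\<close>, so the right-hand side of the commutator identity vanishes and
  \<open>q\<close> cancels.\<close>

lemma symm_iterate:
  assumes "q \<noteq> 0"
    and "scale q (L (conj_transp L f) - conj_transp L (L f)) = Gx (Ga (conj_transp L f - L f))"
    and "symm f" "symm (L f)"
  shows "symm (L (L f))"
proof -
  have *: "conj_transp L f = L f"
    using assms by (simp add: conj_transp_def symm_def)
  then have "scale q (L (L f) - conj_transp L (L f)) = 0"
    using assms(2) by (simp add: op_zero)
  then have "q * (L (L f) - conj_transp L (L f)) h j = 0" for h j
    by (metis scale_def zero_fun_def)
  then have "conj_transp L (L f) = L (L f)"
    using assms(1) by (intro ext) simp
  then show ?thesis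
    using assms by (simp add: conj_transp_def symm_def)
qed

definition opD :: "(nat \<Rightarrow> 'a) \<Rightarrow> nat \<Rightarrow> 'a" where
  "opD f j = [j]\<^sub>q * (f j + f (Suc j))"

definition opF :: "(nat \<Rightarrow> 'a) \<Rightarrow> nat \<Rightarrow> 'a" where
  "opF f j = q ^ j * (f j + f (Suc j))"

text \<open>Where \<open>opF\<close> is invertible, \<open>opX\<close> is \<open>q\<close> times the conjugate of \<open>opD\<close> by \<open>opF\<close>; this form needs no
  division by \<open>q\<close>.\<close>

definition opX :: "(nat \<Rightarrow> 'a) \<Rightarrow> nat \<Rightarrow> 'a" where
  "opX f j = q * [j]\<^sub>q * f j + [Suc j]\<^sub>q * f (Suc j)"

definition Da :: "'a array \<Rightarrow> 'a array" where "Da f h = opD (f h)"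
definition Fa :: "'a array \<Rightarrow> 'a array" where "Fa f h = opF (f h)"
definition Xx :: "'a array \<Rightarrow> 'a array" where "Xx f h j = opX (\<lambda>i. f i j) h"

lemma opD_opE: "opD (opE f) n = q * opE (opD f) n + opD f n + opE f n"
  by (cases n) (simp_all add: opE_def opD_def q_bracket_Suc' algebra_simps)

lemma opF_opE: "opF (opE f) n = opF f n + q * opE (opF f) n"
  by (cases n) (simp_all add: opE_def opF_def q_bracket_Suc' q_power_bracket algebra_simps)

lemma opX_opE_shift: "opX (\<lambda>i. opE f i - shift f i) n
    = q * (opE (opX f) n - shift (opX f) n) + opX f n + q * (opE f n - shift f n)"
  by (cases n) (simp_all add: opE_def opX_def q_bracket_Suc' algebra_simps)

lemma opX_opG: "opX (opG f) n = q * opG (opX f) n + q * opG f n"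
  by (cases n) (simp_all add: opG_def opX_def q_bracket_Suc' q_power_bracket algebra_simps)

lemma a_side_add:
  "Da (f + g) = Da f + Da g" "Fa (f + g) = Fa f + Fa g" "Xx (f + g) = Xx f + Xx g"
  "Da (f - g) = Da f - Da g" "Fa (f - g) = Fa f - Fa g" 
  "Da (scale c f) = scale c (Da f)" "Fa (scale c f) = scale c (Fa f)" "Xx (scale c f) = scale c (Xx f)"
  by (rule ext, rule ext,
      simp add: Da_def Fa_def Xx_def opD_def opF_def opX_def scale_def algebra_simps)+

lemma a_side_commute:
  "Da (Ex f) = Ex (Da f)" "Da (Gx f) = Gx (Da f)" "Da (Sx f) = Sx (Da f)"
  "Fa (Ex f) = Ex (Fa f)" "Fa (Gx f) = Gx (Fa f)" "Fa (Sx f) = Sx (Fa f)"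
  "Xx (Ea f) = Ea (Xx f)" 
  by (rule ext, rule ext, rename_tac h j, case_tac h; case_tac j;
      simp add: op_defs Da_def Fa_def Xx_def opD_def opF_def opX_def algebra_simps)+

lemma Da_Ea: "Da (Ea f) = scale q (Ea (Da f)) + Da f + Ea f"
  by (intro ext) (simp add: Da_def Ea_def[abs_def] opD_opE scale_def)

lemma Fa_Ea: "Fa (Ea f) = Fa f + scale q (Ea (Fa f))"
  by (intro ext) (simp add: Fa_def[abs_def] Ea_def[abs_def] opF_opE scale_def)

lemma Xx_Lam: "Xx (Lam f) = scale q (Lam (Xx f)) + Xx f + scale q (Lam f)"
proof -
  have "Xx (Ex f - Sx f) = scale q (Ex (Xx f) - Sx (Xx f)) + Xx f + scale q (Ex f - Sx f)"
    by (intro ext) (simp add: Xx_def[abs_def] Ex_def Sx_def scale_def opX_opE_shift)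
  moreover have "Xx (Gx g) = scale q (Gx (Xx g)) + scale q (Gx g)" for g
    by (intro ext) (simp add: Xx_def[abs_def] Gx_def[abs_def] scale_def opX_opG)
  ultimately show ?thesis
    by (simp add: Lam_def a_side_add a_side_commute scale_add)
qed

lemma Fa_Lam: "Fa (Lam f) = Fa f + scale q (Lam' (Fa f))"
proof -
  have "Ex g - Sx g + Gx g = g + scale q (Ex g)" for g
    by (intro ext) (simp add: Gx_eq scale_def algebra_simps)
  from this[of "Fa f"] show ?thesis
    by (simp add: Lam_def Lam'_def a_side_add a_side_commute scale_add Fa_Ea op_add op_scale algebra_simps)
qed

lemma Lam_Ea: "Lam (Ea f) = Ea (Lam f)"
  by (simp add: Lam_def op_commute op_add op_diff)

text \<open>Comparing the two sides leaves \<open>q\<close> times \<open>Sx (Da f)\<close>, which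
  the hypothesis turns into \<open>Sx (Xx f)\<close>, that is, \<open>Ex f - Sx f\<close>.\<close>

lemma Da_Lam:
  assumes "scale q (Da f) = Xx f"
  shows "Da (Lam f) = scale q (Lam (Da f)) + Da f + Lam f"
proof -
  have "scale q (Sx (Da f)) = Sx (Xx f)"
    using assms op_scale(3) by metis
  also have "\<dots> = Ex f - Sx f"
  proof (intro ext)
    fix h j show "Sx (Xx f) h j = (Ex f - Sx f) h j"
    by (cases h) (simp_all add: Sx_def Xx_def Ex_def opX_def opE_def q_bracket_Suc' algebra_simps)
  qed
  finally have "scale q (Sx (Da f)) = Ex f - Sx f" .
  then have *: "q * Sx (Da f) h j = Ex f h j - Sx f h j" for h j
    by (metis scale_def fun_diff_def)
  have "Da (Lam f) = Ex (Da f) - Sx (Da f) + Gx (scale q (Ea (Da f)) + Da f + Ea f)"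
    by (simp add: Lam_def a_side_add a_side_commute Da_Ea)
  also have "\<dots> = Ex (Da f) - Sx (Da f) + scale q (Gx (Ea (Da f))) + (Da f + Sx (Da f) - scale (1 - q) (Ex (Da f))) + Gx (Ea f)"
    by (simp add: op_add op_scale) (simp add: Gx_eq[of "Da f"])
  also have "\<dots> = scale q (Lam (Da f)) + Da f + Lam f"
    by (intro ext) (simp add: Lam_def scale_def algebra_simps *)
  finally show ?thesis .
qed


section \<open>The span of the unit array under \<open>Lam\<close>\<close>

definition unit_vec :: "nat \<Rightarrow> 'a" where "unit_vec j = (if j = 0 then 1 else 0)"
definition unit_array :: "'a array" where "unit_array h j = unit_vec h * unit_vec j"

inductive_set Lam_span :: "'a array set" where
  unit: "unit_array \<in> Lam_span"
| add: "f \<in> Lam_span \<Longrightarrow> g \<in> Lam_span \<Longrightarrow> f + g \<in> Lam_span"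
| scale: "f \<in> Lam_span \<Longrightarrow> scale c f \<in> Lam_span"
| Lam: "f \<in> Lam_span \<Longrightarrow> Lam f \<in> Lam_span"

text \<open>Both sides vanish on \<open>unit_array\<close> and obey the same rule for passing
  \<open>Lam\<close>. Thus \<open>Da\<close> on the second index can be traded for an operator on
  the height.\<close>

lemma Lam_span_Xx:
  assumes "f \<in> Lam_span"
  shows "scale q (Da f) = Xx f"
  using assms
proof induction
  case unit
  show ?case
    by (intro ext)
      (simp add: Da_def Xx_def opD_def opX_def unit_array_def unit_vec_def scale_def)
next
  case (Lam f)
  have "scale q (scale q (Lam (Da f))) = scale q (Lam (Xx f))"
    by (simp add: Lam.IH[symmetric] Lam_def op_scale scale_add)
  then show ?case
    by (simp only: Da_Lam[OF Lam.IH] scale_add(1) Xx_Lam Lam.IH)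
next
  case (scale f c)
  have "scale q (Da (scale c f)) = scale c (scale q (Da f))"
    by (simp add: a_side_add scale_add mult.commute)
  then show ?case
    by (simp only: scale.IH a_side_add)
qed (simp_all only: a_side_add scale_add)

lemma Lam_add: "Lam (f + g) = Lam f + Lam g" "Lam (scale c f) = scale c (Lam f)"
  by (simp_all add: Lam_def op_add op_scale scale_add)

lemma Lam'_add: "Lam' (f + g) = Lam' f + Lam' g" "Lam' (scale c f) = scale c (Lam' f)"
  by (simp_all add: Lam'_def op_add op_scale scale_add)

lemma symm_add: "symm f \<Longrightarrow> symm g \<Longrightarrow> symm (f + g)"
  "symm f \<Longrightarrow> symm g \<Longrightarrow> symm (f - g)"
  "symm f \<Longrightarrow> symm (scale c f)"
  by (simp_all add: symm_def op_add op_diff op_scale)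

lemma Lam_span_Da:
  assumes "f \<in> Lam_span"
  shows "Da f \<in> Lam_span"
  using assms
proof induction
  case unit
  have "Da unit_array = scale 0 unit_array"
    by (intro ext) (simp add: Da_def opD_def unit_array_def unit_vec_def scale_def)
  then show ?case
    by (simp add: Lam_span.scale[OF Lam_span.unit])
next
  case (Lam f)
  then show ?case
    by (simp only: Da_Lam Lam_span_Xx) (intro Lam_span.intros)
qed (simp_all only: a_side_add Lam_span.intros)

text \<open>By \<open>Fa_Lam\<close>, applying \<open>Lam\<close> to \<open>f\<close> applies
  \<open>1 + q Lam'\<close> to \<open>Fa f\<close>. Carrying the symmetry of
  \<open>Lam' (Fa f)\<close> along supplies \<open>symm_iterate\<close> with both
  symmetries.\<close>

lemma Lam_span_Fa_symm:
  assumes "f \<in> Lam_span" "q \<noteq> 0"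
  shows "symm (Fa f) \<and> symm (Lam' (Fa f))"
  using assms(1)
proof induction
  case unit
  have "Fa unit_array = unit_array"
    by (intro ext) (simp add: Fa_def opF_def unit_array_def unit_vec_def)
  moreover have "symm unit_array"
    by (simp add: symm_def transp_array_def unit_array_def fun_eq_iff)
  moreover have "symm (Lam' unit_array)"
    unfolding symm_def
  proof (intro ext)
    fix h j
    consider "h = 0" | "h = 1" | i where "h = Suc (Suc i)"
      by (metis One_nat_def not0_implies_Suc)
    note x = this
    consider "j = 0" | "j = 1" | i where "j = Suc (Suc i)"
      by (metis One_nat_def not0_implies_Suc)
    note z = this
    show "transp_array (Lam' unit_array) h j = Lam' unit_array h j"
      by (rule x; rule z; simp add: op_defs Lam'_def transp_array_def unit_array_def unit_vec_def q_bracket_Suc')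
  qed
  ultimately show ?case by simp
next
  case (Lam f)
  then show ?case
    using symm_iterate[OF assms(2) Lam'_commutator, of "Fa f"]
    by (simp only: Fa_Lam Lam'_add symm_add simp_thms)
qed (simp_all only: a_side_add Lam'_add symm_add simp_thms)

text \<open>\<open>Ea\<close> commutes with \<open>Lam\<close>, so applying \<open>Lam\<close> to
  \<open>f\<close> also applies it to \<open>Lam f - Ea f\<close>, and \<open>symm_iterate\<close>
  carries the pair of symmetries on.\<close>

lemma Lam_span_Lam_Ea_symm:
  assumes "f \<in> Lam_span" "q \<noteq> 0"
  shows "symm (Lam f - Ea f) \<and> symm (Lam (Lam f - Ea f))"
  using assms(1)
proof induction
  case unit
  have e: "Lam unit_array - Ea unit_array = (\<lambda>h j. if h = 1 \<and> j = 1 then q else 0)"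
  proof (intro ext)
    fix h j
    consider "h = 0" | "h = 1" | i where "h = Suc (Suc i)"
      by (metis One_nat_def not0_implies_Suc)
    note x = this
    consider "j = 0" | "j = 1" | i where "j = Suc (Suc i)"
      by (metis One_nat_def not0_implies_Suc)
    note z = this
    show "(Lam unit_array - Ea unit_array) h j = (if h = 1 \<and> j = 1 then q else 0)"
      by (rule x; rule z; simp add: op_defs Lam_def unit_array_def unit_vec_def q_bracket_Suc')
  qed
  have "symm (Lam (\<lambda>h j. if h = 1 \<and> j = 1 then q else 0))"
    unfolding symm_def
  proof (intro ext)
    fix h j
    consider "h = 0" | "h = 1" | "h = 2" | i where "h = Suc (Suc (Suc i))"
      by (metis One_nat_def not0_implies_Suc numeral_2_eq_2)
    note x = this
    consider "j = 0" | "j = 1" | "j = 2" | i where "j = Suc (Suc (Suc i))"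
      by (metis One_nat_def not0_implies_Suc numeral_2_eq_2)
    note z = this
    show "transp_array (Lam (\<lambda>h j. if h = 1 \<and> j = 1 then q else 0)) h j
        = Lam (\<lambda>h j. if h = 1 \<and> j = 1 then q else 0) h j"
      by (rule x; rule z; simp add: op_defs Lam_def transp_array_def q_bracket_Suc' numeral_2_eq_2 algebra_simps)
  qed
  then show ?case
    unfolding e by (auto simp: symm_def transp_array_def fun_eq_iff)
next
  case (Lam f)
  have *: "Lam (Lam f) - Ea (Lam f) = Lam (Lam f - Ea f)"
    by (simp add: Lam_Ea[symmetric]) (simp add: Lam_def op_add op_diff)
  show ?case
    unfolding * using symm_iterate[OF assms(2) Lam_commutator, of "Lam f - Ea f"] Lam by blast
next
  case (add f g)
  have "Lam (f + g) - Ea (f + g) = (Lam f - Ea f) + (Lam g - Ea g)"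
    by (simp add: Lam_add op_add)
  then show ?case using add by (simp only: Lam_add symm_add simp_thms)
next
  case (scale f c)
  have "Lam (scale c f) - Ea (scale c f) = scale c (Lam f - Ea f)"
    by (simp add: Lam_add op_scale scale_add)
  then show ?case using scale by (simp only: Lam_add symm_add simp_thms)
qed

end

section \<open>Arrays of path weights\<close>

locale laguerre_arrays = laguerre_operators q for q :: "'a::idom" +
  fixes y \<beta> :: 'a
begin

definition opM :: "(nat \<Rightarrow> 'a) \<Rightarrow> nat \<Rightarrow> 'a" where
  "opM f j = y * (opD f j + \<beta> * opF f j) + opE f j"

definition Ma :: "'a array \<Rightarrow> 'a array" where "Ma f h = opM (f h)"
definition Mx :: "'a array \<Rightarrow> 'a array" where "Mx f h j = opM (\<lambda>i. f i j) h"

primrec K :: "nat \<Rightarrow> 'a array" where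
  "K 0 = unit_array"
| "K (Suc n) = scale y (Da (K n)) + Lam (K n)"

primrec U :: "nat \<Rightarrow> 'a array" where
  "U 0 = 0"
| "U (Suc n) = Mx (U n) + scale y (K n)"

lemma K_span: "K n \<in> Lam_span"
  by (induction n) (simp_all only: K.simps Lam_span_Da Lam_span.intros)

lemma K_Ma_symm: 
  assumes "q \<noteq> 0"
  shows "symm (K (Suc n) - Ma (K n))"
proof -
  have "K (Suc n) - Ma (K n) = (Lam (K n) - Ea (K n)) - scale (y * \<beta>) (Fa (K n))"
    by (intro ext) (simp add: Ma_def opM_def Da_def Ea_def Fa_def scale_def algebra_simps)
  then show ?thesis
    using Lam_span_Lam_Ea_symm[OF K_span[of n] assms] Lam_span_Fa_symm[OF K_span[of n] assms] by (simp only: symm_add)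
qed

lemma M_simps:
  "Mx (f + g) = Mx f + Mx g" "Ma (f + g) = Ma f + Ma g"
  "Mx (f - g) = Mx f - Mx g" "Ma (f - g) = Ma f - Ma g"
  "Mx (scale c f) = scale c (Mx f)" "Ma (scale c f) = scale c (Ma f)"
  "transp_array (Ma f) = Mx (transp_array f)" "Ma (Mx f) = Mx (Ma f)"
proof -
  \<comment> \<open>Only the tridiagonal shape of \<open>opM\<close> matters; opaque coefficients
    keep the brackets out of the simplification.\<close>
  obtain u d r where "opM f j = u j * f (Suc j) + d j * shift f j + r j * f j" for f j
  proof
    show "opM f j = (y * ([j]\<^sub>q + \<beta> * q ^ j)) * f (Suc j) + [j]\<^sub>q * shift f j
        + (y * ([j]\<^sub>q + \<beta> * q ^ j) + [j]\<^sub>q) * f j" for f j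
      by (simp add: opM_def opD_def opE_def opF_def algebra_simps)
  qed
  note M = this
  show "Mx (f + g) = Mx f + Mx g" "Ma (f + g) = Ma f + Ma g"
    "Mx (f - g) = Mx f - Mx g" "Ma (f - g) = Ma f - Ma g"
    "Mx (scale c f) = scale c (Mx f)" "Ma (scale c f) = scale c (Ma f)"
    "transp_array (Ma f) = Mx (transp_array f)" "Ma (Mx f) = Mx (Ma f)"
    by (rule ext, rule ext, rename_tac h j, case_tac h; case_tac j;
        simp add: M Mx_def Ma_def scale_def transp_array_def algebra_simps)+
qed

lemma Mx_Ma_U:
  assumes "q \<noteq> 0"
  shows "Mx (U n) - Ma (U n) = scale y (transp_array (K n) - K n)"
proof (induction n)
  case 0
  show ?case
    using M_simps(3,4)[of 0 0] by (simp add: transp_array_def unit_array_def scale_def[abs_def] zero_fun_def mult.commute)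
next
  case (Suc n)
  have *: "Mx (transp_array (K n)) - Ma (K n) = transp_array (K (Suc n)) - K (Suc n)"
    using K_Ma_symm[OF assms, of n]
    by (simp add: symm_def op_diff M_simps del: K.simps) (simp add: algebra_simps del: K.simps)
  have "Mx (U (Suc n)) - Ma (U (Suc n)) = Mx (Mx (U n) - Ma (U n)) + scale y (Mx (K n) - Ma (K n))"
    by (simp add: M_simps scale_add)
  also have "\<dots> = scale y (Mx (transp_array (K n)) - Ma (K n))"
    by (simp only: Suc M_simps scale_add) simp
  finally show ?case by (simp only: *)
qed

lemma K_column_0: "K n h 0 = (if n = 0 \<and> h = 0 then 1 else 0)"
proof (induction n arbitrary: h)
  case (Suc n)
  \<comment> \<open>In column \<open>0\<close> the operators \<open>Da\<close> and \<open>Ea\<close>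
    vanish by the factor [0] = 0. For \<open>n = 0\<close> the entry 1 at height 0 then matters only
    at height 1, where [1] - 1 = 0.\<close>
  have "K (Suc n) h 0 = [h]\<^sub>q * (K n h 0 + shift (\<lambda>i. K n i 0) h) - shift (\<lambda>i. K n i 0) h"
    by (cases h) (simp_all add: scale_def Da_def opD_def Lam_def op_defs)
  also have "\<dots> = 0"
    by (cases h; cases "h - 1") (simp_all add: Suc q_bracket_Suc')
  finally show ?case by simp
qed (simp add: unit_array_def unit_vec_def)

lemma U_row_0:
  assumes "q \<noteq> 0"
  shows "U (Suc n) 0 j = y * (opM ^^ n) unit_vec j"
proof (induction n arbitrary: j)
  case 0
  show ?case using M_simps(3)[of 0 0]
    by (simp add: scale_def unit_array_def) (simp add: unit_vec_def)
next
  case (Suc n)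
  have "(Mx (U (Suc n)) - Ma (U (Suc n))) 0 j = y * (K (Suc n) j 0 - K (Suc n) 0 j)"
    by (simp only: Mx_Ma_U[OF assms]) (simp add: scale_def transp_array_def)
  \<comment> \<open>Column \<open>0\<close> of \<open>K (Suc n)\<close> is zero, so adding
    \<open>y * K (Suc n) 0 j\<close> exactly makes up the difference of \<open>Mx\<close> and
    \<open>Ma\<close>.\<close>
  then have "U (Suc (Suc n)) 0 j = Ma (U (Suc n)) 0 j"
    by (simp only: K_column_0 U.simps(2)[of "Suc n"]) (simp add: scale_def algebra_simps)
  also have "\<dots> = opM (\<lambda>j. y * (opM ^^ n) unit_vec j) j"
    by (simp add: Ma_def Suc[abs_def] del: U.simps)
  also have "\<dots> = y * opM ((opM ^^ n) unit_vec) j"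
    by (cases j) (simp_all add: opM_def opD_def opE_def opF_def algebra_simps)
  finally show ?case by simp
qed

end

section \<open>Pairing with the left eigenvector of \<open>opE\<close>\<close>

lemma opE_pairing:
  fixes q :: "'a::idom"
  assumes "\<And>j. j < B \<Longrightarrow> \<alpha> * c j = q_bracket q j * c j + q_bracket q (Suc j) * c (Suc j)" "f B = 0"
  shows "(\<Sum>j\<le>B. laguerre_operators.opE q f j * c j) = \<alpha> * (\<Sum>j\<le>B. f j * c j)"
proof -
  \<comment> \<open>Partial sums carry a boundary term at \<open>n\<close>, which
    \<open>f B = 0\<close> removes in the last one.\<close>
  have "(\<Sum>j\<le>n. laguerre_operators.opE q f j * c j) = \<alpha> * (\<Sum>j<n. f j * c j) + q_bracket q n * f n * c n"
    if "n \<le> B" for n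
    using that
  proof (induction n)
    case (Suc n)
    have "\<alpha> * (f n * c n) = f n * (\<alpha> * c n)"
      by (simp add: algebra_simps)
    then show ?case
      using Suc assms(1)[of n] by (simp add: laguerre_operators.opE_def algebra_simps)
  qed (simp add: laguerre_operators.opE_def)
  from this[of B] show ?thesis
    using assms(2) by (simp add: lessThan_Suc_atMost[symmetric])
qed

context laguerre_operators
begin

lemma sum_Ex: "(\<Sum>j\<in>A. Ex f h j * c j) = opE (\<lambda>i. \<Sum>j\<in>A. f i j * c j) h"
  by (cases h) (simp_all add: op_defs sum_distrib_left sum_distrib_right sum.distrib algebra_simps)

lemma sum_Gx: "(\<Sum>j\<in>A. Gx f h j * c j) = opG (\<lambda>i. \<Sum>j\<in>A. f i j * c j) h"
  by (cases h) (simp_all add: op_defs sum_distrib_left sum_distrib_right sum.distrib algebra_simps)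

lemma sum_Sx: "(\<Sum>j\<in>A. Sx f h j * c j) = shift (\<lambda>i. \<Sum>j\<in>A. f i j * c j) h"
  by (cases h) (simp_all add: op_defs)

lemma sum_Xx: "(\<Sum>j\<in>A. Xx f h j * c j) = opX (\<lambda>i. \<Sum>j\<in>A. f i j * c j) h"
  by (simp add: Xx_def opX_def sum_distrib_left sum_distrib_right sum.distrib algebra_simps)

lemma opE_support: "(\<And>j. j > n \<Longrightarrow> f j = 0) \<Longrightarrow> j > Suc n \<Longrightarrow> opE f j = 0"
  by (cases j) (simp_all add: opE_def)

lemma Lam_support:
  assumes "\<And>h j. j > n \<Longrightarrow> f h j = 0" "j > Suc n"
  shows "Lam f h j = 0"
proof -
  have "Ea f i j = 0" for i
    using opE_support[of n "f i" j] assms by (simp add: Ea_def)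
  then show ?thesis
    using assms by (cases h) (simp_all add: Lam_def Ex_def Sx_def Gx_def opG_def opE_def)
qed

end

context laguerre_arrays
begin

lemma K_support: "j > n \<Longrightarrow> K n h j = 0"
proof (induction n arbitrary: h j)
  case (Suc n)
  then show ?case
    using Lam_support[of n "K n" j h] by (simp add: scale_def Da_def opD_def)
qed (simp add: unit_array_def unit_vec_def)

lemma sum_Mx: "(\<Sum>j\<in>A. Mx f h j * c j) = opM (\<lambda>i. \<Sum>j\<in>A. f i j * c j) h"
  by (cases h) (simp_all add: Mx_def opM_def opD_def opF_def opE_def sum_distrib_left sum_distrib_right
      sum.distrib algebra_simps)

end

text \<open>\<open>W n h\<close> and \<open>V n h\<close> are the generating functions of the paths of \<open>n\<close> steps from height \<open>h\<close> to \<open>0\<close>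
  without, respectively with, type 1 steps; in \<open>V\<close> the last type 1 step does not count for \<open>\<beta>\<close>.\<close>

locale laguerre_transfer = laguerre_arrays q y \<beta> for q y \<beta> :: "'a::idom" +
  fixes \<alpha> :: 'a and c :: "nat \<Rightarrow> 'a" and B :: nat and W V :: "'a array"
  assumes c: "\<And>j. j < B \<Longrightarrow> \<alpha> * c j = [j]\<^sub>q * c j + [Suc j]\<^sub>q * c (Suc j)" and q_nonzero: "q \<noteq> 0"
    and W_0: "\<And>h. W 0 h = unit_vec h"
    and W_Suc_0: "\<And>n. W (Suc n) 0 = 0"
    and W_Suc_Suc: "\<And>n h. W (Suc n) (Suc h) = y * [Suc h]\<^sub>q * (W n (Suc h) + W n (Suc (Suc h)))
      + ([h]\<^sub>q + \<alpha> * q ^ h) * (W n (Suc h) + W n h)"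
    and V_0: "\<And>h. V 0 h = 0"
    and V_Suc: "\<And>n h. V (Suc n) h = opM (V n) h + y * opF (W n) h"
begin

text \<open>Trading \<open>q * Da\<close> for \<open>Xx\<close>, and \<open>Ea\<close> for the
  factor \<alpha>, leaves a recurrence in the height alone. The bound on \<open>n\<close> makes
  column \<open>B\<close> of \<open>K n\<close> vanish, as \<open>opE_pairing\<close>
  requires.\<close>

lemma sum_K_recurrence:
  assumes "n < B"
    and P: "\<And>n h. P n h = (\<Sum>j\<le>B. K n h j * c j)"
  shows "q * P (Suc n) h = y * opX (P n) h + q * (opE (P n) h - shift (P n) h + \<alpha> * opG (P n) h)"
proof -
  have P_abs: "(\<lambda>i. \<Sum>j\<le>B. K n i j * c j) = P n"
    by (simp add: P[abs_def])
  have "(\<Sum>j\<le>B. Ea (K n) i j * c j) = \<alpha> * P n i" for i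
    using opE_pairing[of B \<alpha> c q "K n i", OF c] K_support[of n B i] assms by (simp add: Ea_def)
  then have "(\<Sum>j\<le>B. Gx (Ea (K n)) h j * c j) = opG (\<lambda>i. \<alpha> * P n i) h"
    by (simp add: sum_Gx)
  also have "\<dots> = \<alpha> * opG (P n) h"
    by (cases h) (simp_all add: opG_def algebra_simps)
  finally have Lam: "(\<Sum>j\<le>B. Lam (K n) h j * c j) = opE (P n) h - shift (P n) h + \<alpha> * opG (P n) h"
    by (simp add: Lam_def distrib_right left_diff_distrib sum.distrib sum_subtractf sum_Ex sum_Sx P_abs)
  have "q * Da (K n) h j = Xx (K n) h j" for j
    using Lam_span_Xx[OF K_span[of n]] by (metis scale_def)
  then have "q * (\<Sum>j\<le>B. Da (K n) h j * c j) = (\<Sum>j\<le>B. Xx (K n) h j * c j)"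
    by (simp add: sum_distrib_left mult.assoc[symmetric])
  then have Da: "q * (\<Sum>j\<le>B. Da (K n) h j * c j) = opX (P n) h"
    by (simp add: sum_Xx P_abs)
  have "P (Suc n) h = y * (\<Sum>j\<le>B. Da (K n) h j * c j) + (\<Sum>j\<le>B. Lam (K n) h j * c j)"
    unfolding P by (simp add: scale_def sum_distrib_left sum.distrib algebra_simps)
  then have "q * P (Suc n) h = y * (q * (\<Sum>j\<le>B. Da (K n) h j * c j)) + q * (\<Sum>j\<le>B. Lam (K n) h j * c j)"
    by (simp add: algebra_simps)
  then show ?thesis
    by (simp only: Lam Da)
qed

text \<open>\<open>y * opF (W n) h\<close> counts a type 1 step from height \<open>h\<close>, level
  or up, followed by \<open>n\<close> steps without type 1 steps. Up to the factor \<open>q\<close>,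
  both sides obey the recurrence of \<open>sum_K_recurrence\<close>.\<close>

lemma sum_K:
  assumes "n \<le> B"
  shows "(\<Sum>j\<le>B. K n h j * c j) = c 0 * opF (W n) h"
  using \<open>n \<le> B\<close>
proof (induction n arbitrary: h)
  case 0
  have "(\<Sum>j\<le>B. unit_array h j * c j) = unit_vec h * c 0"
    by (simp add: sum.atMost_shift unit_array_def unit_vec_def)
  then show ?case
    by (cases h) (simp_all add: opF_def W_0 unit_vec_def)
next
  case (Suc n)
  define P where "P n h = (\<Sum>j\<le>B. K n h j * c j)" for n h
  have IH: "P n h = c 0 * opF (W n) h" for h
    using Suc by (simp add: P_def)
  have "q * P (Suc n) h = y * opX (P n) h + q * (opE (P n) h - shift (P n) h + \<alpha> * opG (P n) h)"
    by (rule sum_K_recurrence[OF _ P_def]) (use Suc.prems in auto)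
  also have "\<dots> = q * (c 0 * opF (W (Suc n)) h)"
    by (cases h) (simp_all add: IH opX_def opE_def opG_def opF_def W_Suc_0 W_Suc_Suc q_bracket_Suc' q_power_bracket algebra_simps)
  finally show ?case
    using q_nonzero by (simp add: P_def)
qed

lemma sum_U:
  assumes "n \<le> Suc B"
  shows "(\<Sum>j\<le>B. U n h j * c j) = c 0 * V n h"
  using \<open>n \<le> Suc B\<close>
proof (induction n arbitrary: h)
  case (Suc n)
  have "(\<Sum>j\<le>B. U (Suc n) h j * c j) = opM (\<lambda>i. \<Sum>j\<le>B. U n i j * c j) h + y * (\<Sum>j\<le>B. K n h j * c j)"
    by (simp add: scale_def distrib_right sum.distrib sum_Mx sum_distrib_left mult.assoc)
  also have "\<dots> = opM (\<lambda>i. c 0 * V n i) h + y * (c 0 * opF (W n) h)"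
    using Suc sum_K[of n h] by simp
  also have "\<dots> = c 0 * V (Suc n) h"
    by (cases h) (simp_all add: V_Suc opM_def opD_def opF_def opE_def algebra_simps)
  finally show ?case .
qed (simp add: V_0)

text \<open>Row \<open>0\<close> of \<open>U (Suc n)\<close> is evaluated twice: as a path count by
  \<open>sum_U\<close> and through a power of \<open>opM\<close> by \<open>U_row_0\<close>.\<close>

lemma transfer_identity:
  assumes "n \<le> B"
  shows "c 0 * V (Suc n) 0 = y * (\<Sum>j\<le>B. (opM ^^ n) unit_vec j * c j)"
  using sum_U[of "Suc n" 0] \<open>n \<le> B\<close>
  by (simp add: U_row_0[OF q_nonzero] sum_distrib_left mult.assoc del: U.simps)

end

text \<open>The coefficient \<open>(\<Prod>i<j. \<alpha> - [i]) / [j]!\<close> multiplied by \<open>[B]!\<close> to avoid fractions.\<close>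

definition pairing_coeff :: "'a::idom \<Rightarrow> 'a \<Rightarrow> nat \<Rightarrow> nat \<Rightarrow> 'a" where
  "pairing_coeff q \<alpha> B j = (\<Prod>i<j. \<alpha> - q_bracket q i) * (\<Prod>i=Suc j..B. q_bracket q i)"

lemma pairing_coeff_recurrence:
  assumes "j < B"
  shows "\<alpha> * pairing_coeff q \<alpha> B j
    = q_bracket q j * pairing_coeff q \<alpha> B j + q_bracket q (Suc j) * pairing_coeff q \<alpha> B (Suc j)"
proof -
  have "(\<Prod>i=Suc j..B. q_bracket q i) = q_bracket q (Suc j) * (\<Prod>i=Suc (Suc j)..B. q_bracket q i)"
    using assms by (simp add: prod.atLeast_Suc_atMost)
  then show ?thesis
    by (simp add: pairing_coeff_def algebra_simps)
qed

section \<open>Laguerre histories by their first step\<close>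

text \<open>The truncation at height 0 is harmless, as \<open>step_weights Down 0\<close> is
  empty.\<close>

fun next_height :: "direction \<Rightarrow> nat \<Rightarrow> nat" where
  "next_height Up h = Suc h"
| "next_height Level h = h"
| "next_height Down h = h - 1"

primrec histories_from :: "nat \<Rightarrow> nat \<Rightarrow> history set" where
  "histories_from 0 h = (if h = 0 then {[]} else {})"
| "histories_from (Suc n) h =
    (\<Union>d\<in>{Up, Level, Down}. \<Union>w\<in>step_weights d h. Cons (d, w) ` histories_from n (next_height d h))"

lemma next_height_rise: "w \<in> step_weights d h \<Longrightarrow> int (next_height d h) = int h + rise d"
  by (cases d) auto

lemma height_Cons: "height (s # H) (Suc k) = rise (fst s) + height H k"
  by (simp add: height_def sum.lessThan_Suc_shift del: sum.lessThan_Suc)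

lemma height_0: "height H 0 = 0"
  by (simp add: height_def)

lemma histories_from_iff:
  "H \<in> histories_from n h \<longleftrightarrow> length H = n \<and> (\<forall>k\<le>n. 0 \<le> int h + height H k) \<and> int h + height H n = 0
    \<and> (\<forall>k<n. snd (H ! k) \<in> step_weights (fst (H ! k)) (nat (int h + height H k)))"
proof (induction n arbitrary: h H)
  case 0
  then show ?case by (auto simp: height_0)
next
  case (Suc n)
  show ?case
  proof (cases H)
    case Nil
    then show ?thesis by auto
  next
    case (Cons s H')
    obtain d w where s: "s = (d, w)" by (cases s)
    have d: "d \<in> {Up, Level, Down}" by (cases d) auto
    have "H \<in> histories_from (Suc n) h \<longleftrightarrow> w \<in> step_weights d h \<and> H' \<in> histories_from n (next_height d h)"
      using d by (auto simp: Cons s image_iff)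
    also have "\<dots> \<longleftrightarrow> w \<in> step_weights d h \<and> (length H' = n \<and> (\<forall>k\<le>n. 0 \<le> int h + height H (Suc k)) \<and> int h + height H (Suc n) = 0
      \<and> (\<forall>k<n. snd (H ! Suc k) \<in> step_weights (fst (H ! Suc k)) (nat (int h + height H (Suc k)))))"
      by (rule conj_cong[OF refl]) (simp add: Suc Cons s height_Cons next_height_rise add.assoc)
    finally show ?thesis
      by (auto simp: Cons s height_0 All_less_Suc2 all_simps less_Suc_eq_le[symmetric] simp del: less_Suc_eq_le)
  qed
qed

lemma laguerre_histories_eq: "laguerre_histories n = histories_from n 0"
  by (auto simp: laguerre_histories_def motzkin_path_def histories_from_iff)

lemma var_q_power: "var_q ^ i = [:monom 1 i:]"
  by (induction i) (simp_all add: var_q_def monom_Suc one_pCons)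

lemma var_y_neq_0 [simp]: "var_y \<noteq> 0"
  by (simp add: var_y_def)

text \<open>The weights are distinct monomials, so sums over sets of weights become sums over
  exponents and the type of a step can be read off its weight.\<close>

lemma weight_eq_iff [simp]:
  "var_y * var_q ^ i = var_y * var_q ^ j \<longleftrightarrow> i = j"
  "var_q ^ i = var_q ^ j \<longleftrightarrow> i = j"
  "var_y * var_q ^ i \<noteq> var_q ^ j"
  "var_q ^ j \<noteq> var_y * var_q ^ i"
  by (auto simp: var_q_power var_y_def monom_eq_iff')

lemma sum_step_weights:
  "(\<Sum>w\<in>step_weights Up h. f w) = (\<Sum>i\<le>h. f (var_y * var_q ^ i))"
  "(\<Sum>w\<in>step_weights Down h. f w) = (\<Sum>i<h. f (var_q ^ i))"
  "(\<Sum>w\<in>step_weights Level h. f w) = (\<Sum>i\<le>h. f (var_y * var_q ^ i)) + (\<Sum>i<h. f (var_q ^ i))"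
proof -
  have u: "step_weights Up h = (\<lambda>i. var_y * var_q ^ i) ` {..h}"
    and d: "step_weights Down h = (\<lambda>i. var_q ^ i) ` {..<h}"
    and l: "step_weights Level h = step_weights Up h \<union> step_weights Down h"
    by auto
  show up: "(\<Sum>w\<in>step_weights Up h. f w) = (\<Sum>i\<le>h. f (var_y * var_q ^ i))"
    unfolding u by (subst sum.reindex) (auto simp: inj_on_def)
  show down: "(\<Sum>w\<in>step_weights Down h. f w) = (\<Sum>i<h. f (var_q ^ i))"
    unfolding d by (subst sum.reindex) (auto simp: inj_on_def)
  have "(\<Sum>w\<in>step_weights Level h. f w) = (\<Sum>w\<in>step_weights Up h. f w) + (\<Sum>w\<in>step_weights Down h. f w)"
    unfolding l by (rule sum.union_disjoint) (auto simp: u d simp del: step_weights.simps)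
  then show "(\<Sum>w\<in>step_weights Level h. f w) = (\<Sum>i\<le>h. f (var_y * var_q ^ i)) + (\<Sum>i<h. f (var_q ^ i))"
    by (simp only: up down)
qed

lemma sum_direction: "(\<Sum>d\<in>{Up, Level, Down}. f d) = f Up + (f Level + f Down)"
  by simp

lemma finite_step_weights: "finite (step_weights d h)"
  by (cases d) auto

lemma finite_histories_from: "finite (histories_from n h)"
  by (induction n arbitrary: h) (auto simp: finite_step_weights simp del: step_weights.simps)

lemma sum_histories_from_Suc:
  "(\<Sum>H\<in>histories_from (Suc n) h. f H) =
    (\<Sum>d\<in>{Up, Level, Down}. \<Sum>w\<in>step_weights d h. \<Sum>H\<in>histories_from n (next_height d h). f ((d, w) # H))"
  unfolding histories_from.simps
  apply (subst sum.UNION_disjoint)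
     apply simp
    apply (simp add: finite_step_weights finite_histories_from)
   apply (auto)[1]
  apply (rule sum.cong[OF refl])
  apply (subst sum.UNION_disjoint)
     apply (simp add: finite_step_weights finite_histories_from)
    apply (simp add: finite_step_weights finite_histories_from)
   apply (auto)[1]
  apply (rule sum.cong[OF refl])
  apply (subst sum.reindex)
   apply (auto simp: inj_on_def)
  done

section \<open>Recursive counts of the marked steps\<close>

fun type1_count :: "nat \<Rightarrow> history \<Rightarrow> nat" where
  "type1_count h [] = 0"
| "type1_count h ((d, w) # H) = of_bool (w = var_y * var_q ^ h) + type1_count (next_height d h) H"

text \<open>A type 2 step counts when no type 1 step follows it; the recursion tests this on the
  list from that step on.\<close>

fun type2_count :: "nat \<Rightarrow> history \<Rightarrow> nat" where
  "type2_count h [] = 0"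
| "type2_count h ((d, w) # H) =
    of_bool (0 < h \<and> w = var_q ^ (h - 1) \<and> type1_count h ((d, w) # H) = 0) + type2_count (next_height d h) H"

definition type1_from :: "nat \<Rightarrow> history \<Rightarrow> nat set" where
  "type1_from h H = {k. k < length H \<and> snd (H ! k) = var_y * var_q ^ nat (int h + height H k)}"

definition type2_from :: "nat \<Rightarrow> history \<Rightarrow> nat set" where
  "type2_from h H = {k. k < length H \<and> 1 \<le> int h + height H k
     \<and> snd (H ! k) = var_q ^ nat (int h + height H k - 1)}"

lemma Collect_nat_split: "{k. P k} = (if P 0 then {0} else {}) \<union> Suc ` {k. P (Suc k)}"
proof (rule set_eqI)
  fix k show "k \<in> {k. P k} \<longleftrightarrow> k \<in> (if P 0 then {0} else {}) \<union> Suc ` {k. P (Suc k)}"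
    by (cases k) auto
qed

lemma type1_from_Cons:
  assumes "w \<in> step_weights d h"
  shows "type1_from h ((d, w) # H)
    = (if w = var_y * var_q ^ h then {0} else {}) \<union> Suc ` type1_from (next_height d h) H"
  unfolding type1_from_def
  by (subst Collect_nat_split)
    (simp add: height_0 height_Cons next_height_rise[OF assms] add.assoc)

lemma type2_from_Cons:
  assumes "w \<in> step_weights d h"
  shows "type2_from h ((d, w) # H)
    = (if 0 < h \<and> w = var_q ^ (h - 1) then {0} else {}) \<union> Suc ` type2_from (next_height d h) H"
  unfolding type2_from_def
  by (subst Collect_nat_split)
    (auto simp add: height_0 height_Cons next_height_rise[OF assms] add.assoc nat_diff_distrib)

lemma finite_type_from: "finite (type1_from h H)" "finite (type2_from h H)"
  by (simp_all add: type1_from_def type2_from_def)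

lemma card_if_union:
  "finite A \<Longrightarrow> card ((if P then {0} else {}) \<union> Suc ` A) = of_bool P + card A"
  by (subst card_Un_disjoint) (auto simp: card_image)

lemma card_type1_from: "H \<in> histories_from n h \<Longrightarrow> card (type1_from h H) = type1_count h H"
proof (induction n arbitrary: h H)
  case 0
  then show ?case by (auto simp: type1_from_def split: if_splits)
next
  case (Suc n)
  then obtain d w H' where H: "H = (d, w) # H'" "w \<in> step_weights d h" "H' \<in> histories_from n (next_height d h)"
    by (auto simp del: step_weights.simps)
  then show ?case
    using Suc.IH[OF H(3)] by (simp add: type1_from_Cons card_if_union finite_type_from)
qed

lemma card_type2_from:
  "H \<in> histories_from n h \<Longrightarrow> card {k \<in> type2_from h H. \<forall>l\<in>type1_from h H. l < k} = type2_count h H"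
proof (induction n arbitrary: h H)
  case 0
  then show ?case by (auto simp: type2_from_def split: if_splits)
next
  case (Suc n)
  then obtain d w H' where H: "H = (d, w) # H'" "w \<in> step_weights d h" "H' \<in> histories_from n (next_height d h)"
    by (auto simp del: step_weights.simps)
  let ?h = "next_height d h"
  \<comment> \<open>Position \<open>0\<close> lies to the right of every type 1 step only if there
    is none.\<close>
  have "type1_from h H = {} \<longleftrightarrow> type1_count h H = 0"
    using card_type1_from[OF Suc.prems] finite_type_from(1)[of h H] by (metis card_0_eq)
  then have "{k \<in> type2_from h H. \<forall>l\<in>type1_from h H. l < k}
    = (if 0 < h \<and> w = var_q ^ (h - 1) \<and> type1_count h H = 0 then {0} else {})
      \<union> Suc ` {k \<in> type2_from ?h H'. \<forall>l\<in>type1_from ?h H'. l < k}"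
    unfolding H(1) type2_from_Cons[OF H(2)]
    by (subst Collect_nat_split) (auto simp: type1_from_Cons[OF H(2)])
  then show ?case
    using Suc.IH[OF H(3)] H(1) by (simp add: card_if_union finite_type_from)
qed

lemma t1_eq: "H \<in> histories_from n 0 \<Longrightarrow> t1 H = type1_count 0 H"
  using card_type1_from[of H n 0] by (simp add: t1_def type1_steps_def type1_from_def)

lemma t2_eq: "H \<in> histories_from n 0 \<Longrightarrow> t2 H = type2_count 0 H"
  using card_type2_from[of H n 0]
  by (simp add: t2_def type1_steps_def type1_from_def type2_steps_def type2_from_def)

lemma poly_const_simps:
  "poly_const (a * b) = poly_const a * poly_const b"
  "poly_const (a ^ n) = poly_const a ^ n"
  "poly_const 1 = 1"
proof -
  show *: "poly_const (a * b) = poly_const a * poly_const b" for a b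
    by (simp add: poly_const_def)
  show "poly_const 1 = 1"
    by (simp add: poly_const_def one_pCons)
  then show "poly_const (a ^ n) = poly_const a ^ n"
    by (induction n) (simp_all add: *)
qed

lemma total_weight_Cons: "total_weight ((d, w) # H) = w * total_weight H"
  by (simp add: total_weight_def prod.lessThan_Suc_shift del: prod.lessThan_Suc)

section \<open>Transfer recurrences for the path sums\<close>

definition wt_no_type1 :: "nat \<Rightarrow> history \<Rightarrow> poly_yqab" where
  "wt_no_type1 h H = (if type1_count h H = 0 then poly_const (total_weight H) * var_alpha ^ type2_count h H else 0)"

definition wt_type1 :: "nat \<Rightarrow> history \<Rightarrow> poly_yqab" where
  "wt_type1 h H = (if type1_count h H = 0 then 0 else
     poly_const (total_weight H) * var_beta ^ (type1_count h H - 1) * var_alpha ^ type2_count h H)"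

lemma wt_no_type1_Cons:
  "wt_no_type1 h ((d, w) # H) = poly_const w * (if w = var_y * var_q ^ h then 0
     else if 0 < h \<and> w = var_q ^ (h - 1) then var_alpha else 1) * wt_no_type1 (next_height d h) H"
  by (simp add: wt_no_type1_def total_weight_Cons poly_const_simps)

text \<open>A type 1 first step gets \<open>var_beta\<close> exactly when another type 1 step
  follows; otherwise it is the last one and the tail has none.\<close>

lemma wt_type1_Cons:
  "wt_type1 h ((d, w) # H) = poly_const w * (if w = var_y * var_q ^ h
     then var_beta * wt_type1 (next_height d h) H + wt_no_type1 (next_height d h) H
     else wt_type1 (next_height d h) H)"
  by (cases "type1_count (next_height d h) H")
    (simp_all add: wt_no_type1_def wt_type1_def total_weight_Cons poly_const_simps)

definition sum_no_type1 :: "nat \<Rightarrow> nat \<Rightarrow> poly_yqab" where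
  "sum_no_type1 n h = (\<Sum>H\<in>histories_from n h. wt_no_type1 h H)"

definition sum_type1 :: "nat \<Rightarrow> nat \<Rightarrow> poly_yqab" where
  "sum_type1 n h = (\<Sum>H\<in>histories_from n h. wt_type1 h H)"

abbreviation (input) Q where "Q \<equiv> poly_const var_q"
abbreviation (input) Y where "Y \<equiv> poly_const var_y"

lemma sum_no_type1_0: "sum_no_type1 0 h = (if h = 0 then 1 else 0)"
  by (simp add: sum_no_type1_def wt_no_type1_def total_weight_def poly_const_simps)

lemma sum_type1_0: "sum_type1 0 h = 0"
  by (simp add: sum_type1_def wt_type1_def)

text \<open>The sum of the weights \<open>1, ..., q^(h-1)\<close> available at height
  \<open>h\<close>, with the type 2 weight \<open>q^(h-1)\<close> multiplied by \<alpha>.\<close>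

primrec marked_bracket :: "nat \<Rightarrow> poly_yqab" where
  "marked_bracket 0 = 0"
| "marked_bracket (Suc h) = q_bracket Q h + var_alpha * Q ^ h"

lemma sum_no_type1_Suc:
  "sum_no_type1 (Suc n) h = Y * q_bracket Q h * (sum_no_type1 n h + sum_no_type1 n (Suc h))
    + marked_bracket h * (sum_no_type1 n h + shift (sum_no_type1 n) h)"
proof -
  have y: "(\<Sum>i\<le>h. poly_const (var_y * var_q ^ i) * (if var_y * var_q ^ i = var_y * var_q ^ h then 0
     else if 0 < h \<and> var_y * var_q ^ i = var_q ^ (h - 1) then var_alpha else 1) * c)
     = Y * q_bracket Q h * c" for c
    by (simp add: lessThan_Suc_atMost[symmetric] q_bracket_def poly_const_simps sum_distrib_left sum_distrib_right)
  have q: "(\<Sum>i<h. poly_const (var_q ^ i) * (if var_q ^ i = var_y * var_q ^ h then 0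
     else if 0 < h \<and> var_q ^ i = var_q ^ (h - 1) then var_alpha else 1) * c)
     = marked_bracket h * c" for c
    by (cases h) (simp_all del: power_Suc add: q_bracket_def poly_const_simps sum_distrib_left sum_distrib_right algebra_simps)
  have *: "marked_bracket h * sum_no_type1 n (h - Suc 0) = marked_bracket h * shift (sum_no_type1 n) h"
    by (cases h) simp_all
  show ?thesis
    unfolding sum_no_type1_def[of "Suc n"] sum_histories_from_Suc sum_direction wt_no_type1_Cons 
      sum_distrib_left[symmetric] sum_no_type1_def[symmetric] sum_step_weights y q
    by (simp add: * algebra_simps)
qed

lemma sum_type1_Suc:
  "sum_type1 (Suc n) h = Y * (q_bracket Q h + var_beta * Q ^ h) * (sum_type1 n h + sum_type1 n (Suc h))
    + q_bracket Q h * (sum_type1 n h + shift (sum_type1 n) h)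
    + Y * Q ^ h * (sum_no_type1 n h + sum_no_type1 n (Suc h))"
proof -
  have y: "(\<Sum>i\<le>h. poly_const (var_y * var_q ^ i) * (if var_y * var_q ^ i = var_y * var_q ^ h then c else d))
     = Y * q_bracket Q h * d + Y * Q ^ h * c" for c d
    by (simp add: lessThan_Suc_atMost[symmetric] q_bracket_def poly_const_simps sum_distrib_left sum_distrib_right)
  have q: "(\<Sum>i<h. poly_const (var_q ^ i) * (if var_q ^ i = var_y * var_q ^ h then c else d)) = q_bracket Q h * d" for c d
    by (simp add: q_bracket_def poly_const_simps sum_distrib_left sum_distrib_right)
  have *: "q_bracket Q h * sum_type1 n (h - Suc 0) = q_bracket Q h * shift (sum_type1 n) h"
    by (cases h) (simp_all add: q_bracket_def)
  have i: "(\<Sum>H\<in>A. if P then f H else g H) = (if P then sum f A else sum g A)" for P A and f g :: "history \<Rightarrow> poly_yqab"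
    by simp
  show ?thesis
    unfolding sum_type1_def[of "Suc n"] sum_histories_from_Suc wt_type1_Cons 
      sum_direction sum_distrib_left[symmetric] i sum.distrib sum_type1_def[symmetric] sum_no_type1_def[symmetric]
      sum_step_weights y q
    by (simp add: * algebra_simps)
qed

lemma sum_laguerre_histories:
  "(\<Sum>H\<in>laguerre_histories (Suc n). poly_const (total_weight H) * var_beta ^ (t1 H - 1) * var_alpha ^ t2 H)
    = sum_type1 (Suc n) 0"
  unfolding laguerre_histories_eq sum_type1_def
proof (rule sum.cong[OF refl])
  fix H assume H: "H \<in> histories_from (Suc n) 0"
  then have "0 < type1_count 0 H"
    using t1_pos[of H n] by (simp add: laguerre_histories_eq t1_eq[OF H] del: histories_from.simps)
  then show "poly_const (total_weight H) * var_beta ^ (t1 H - 1) * var_alpha ^ t2 H = wt_type1 0 H"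
    by (simp add: wt_type1_def t1_eq[OF H] t2_eq[OF H])
qed

section \<open>The partition function as a matrix element\<close>

lemma poly_const_monomial: "poly_const a * var_alpha ^ i * var_beta ^ j = monom (monom a j) i"
proof -
  have "var_alpha ^ i = monom 1 i"
    by (induction i) (simp_all add: var_alpha_def monom_Suc monom_eq_1)
  moreover have "var_beta ^ j = [:monom 1 j:]"
    by (induction j) (simp_all add: var_beta_def monom_Suc monom_eq_1)
  ultimately show ?thesis
    by (simp add: poly_const_def smult_monom)
qed

text \<open>The types \<^typ>\<open>nf_module\<close> and \<^typ>\<open>poly_yqab\<close> are the same, with \<open>E, D\<close> in the places of
  \<open>\<alpha>, \<beta>\<close>.\<close>

lemma Zbar_eq_act: "Zbar N = act_alg ((alg_const var_y * alg_D + alg_E) ^ N) 1"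
proof -
  let ?x = "(alg_const var_y * alg_D + alg_E) ^ N"
  have nf: "normal_form ?x (nf_coeff ?x)"
    unfolding nf_coeff_def by (rule theI'[OF ex1_normal_form])
  then have "act_alg ?x 1 = act_alg (\<Sum>(i, j) | nf_coeff ?x i j \<noteq> 0. alg_const (nf_coeff ?x i j) * alg_E ^ i * alg_D ^ j) 1"
    unfolding normal_form_def by metis
  also have "\<dots> = (\<Sum>(i, j) | nf_coeff ?x i j \<noteq> 0. monom (monom (nf_coeff ?x i j) j) i)"
    by (simp add: act_alg_sum case_prod_unfold act_alg_monomial)
  finally show ?thesis
    by (simp add: Zbar_def Let_def poly_const_monomial)
qed

section \<open>The algebra acting on functions of the height\<close>

interpretation pasep: laguerre_arrays "poly_const var_q" "poly_const var_y" var_beta .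

text \<open>\<open>vec_of\<close> sends \<open>E^i D^j\<close> to \<open>\<beta>^j E^i e\<close>.\<close>

definition vec_of :: "nf_module \<Rightarrow> nat \<Rightarrow> poly_yqab" where
  "vec_of v = fold_coeffs (\<lambda>p f j. [:p:] * pasep.unit_vec j + pasep.opE f j) v (\<lambda>_. 0)"

lemma vec_of_0: "vec_of 0 j = 0"
  by (simp add: vec_of_def)

lemma vec_of_pCons: "vec_of (pCons p v) j = [:p:] * pasep.unit_vec j + pasep.opE (vec_of v) j"
proof (cases "p = 0 \<and> v = 0")
  case True
  then show ?thesis
    by (cases j) (simp_all add: vec_of_def pasep.opE_def)
next
  case False
  then show ?thesis by (auto simp: vec_of_def)
qed

lemma opE_linear: "pasep.opE (\<lambda>j. f j + g j) j = pasep.opE f j + pasep.opE g j"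
  "pasep.opE (\<lambda>j. a * f j) j = a * pasep.opE f j"
  by (cases j; simp add: pasep.opE_def algebra_simps)+

lemma vec_of_add: "vec_of (u + v) j = vec_of u j + vec_of v j"
proof (induction u v arbitrary: j rule: poly_induct2)
  case (pCons a u b v)
  have "vec_of (u + v) = (\<lambda>j. vec_of u j + vec_of v j)"
    by (rule ext) (rule pCons)
  moreover have "pCons a u + pCons b v = pCons (a + b) (u + v)"
    by simp
  moreover have "[:a + b:] * x = [:a:] * x + [:b:] * x" for x :: poly_yqab
    by (simp add: smult_add_left)
  ultimately show ?case
    by (simp only: vec_of_pCons opE_linear add.assoc add.left_commute)
qed (simp add: vec_of_0)

lemma vec_of_smult: "vec_of (smult a v) j = [:a:] * vec_of v j"
proof (induction v arbitrary: j)
  case (pCons p v)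
  have "vec_of (smult a v) = (\<lambda>j. [:a:] * vec_of v j)"
    by (rule ext) (rule pCons)
  moreover have "[:a * p:] = [:a:] * [:p:]"
    by simp
  ultimately show ?case
    by (simp only: smult_pCons vec_of_pCons opE_linear distrib_left mult.assoc)
qed (simp add: vec_of_0)

lemma vec_of_smult_const: "vec_of (smult [:k:] v) j = poly_const k * vec_of v j"
  unfolding poly_const_def by (rule vec_of_smult)

definition opD\<beta> :: "(nat \<Rightarrow> poly_yqab) \<Rightarrow> nat \<Rightarrow> poly_yqab" where
  "opD\<beta> f j = pasep.opD f j + var_beta * pasep.opF f j"

text \<open>The defining relation of the algebra for the images of D and E; it makes
  \<open>vec_of\<close> compatible with \<open>act_D\<close>.\<close>

lemma opD\<beta>_opE: "opD\<beta> (pasep.opE f) j = poly_const var_q * pasep.opE (opD\<beta> f) j + opD\<beta> f j + pasep.opE f j"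
proof -
  have "pasep.opE (opD\<beta> f) j = pasep.opE (pasep.opD f) j + var_beta * pasep.opE (pasep.opF f) j"
    unfolding opD\<beta>_def[abs_def] opE_linear ..
  then show ?thesis
    by (simp add: opD\<beta>_def pasep.opD_opE pasep.opF_opE algebra_simps)
qed

lemma opD\<beta>_linear: "opD\<beta> (\<lambda>j. f j + g j) j = opD\<beta> f j + opD\<beta> g j"
  by (simp add: opD\<beta>_def pasep.opD_def pasep.opF_def algebra_simps)

lemma vec_of_act_E: "vec_of (act_E v) = pasep.opE (vec_of v)"
  by (rule ext) (simp add: act_E_def vec_of_pCons)

lemma vec_of_act_D: "vec_of (act_D v) j = opD\<beta> (vec_of v) j"
proof (induction v arbitrary: j)
  case 0
  show ?case
    by (simp add: act_D_def vec_of_0 opD\<beta>_def pasep.opD_def pasep.opF_def)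
next
  case (pCons p v)
  have IH: "vec_of (act_D v) = opD\<beta> (vec_of v)"
    by (rule ext) (rule pCons)
  have "pCons p v = [:p:] + act_E v"
    by (simp add: act_E_def)
  then have "act_D (pCons p v) = [:pCons 0 p:] + (smult [:var_q:] (act_E (act_D v)) + act_D v + act_E v)"
    by (simp only: act_D_add act_D_E) (simp add: act_D_def)
  \<comment> \<open>\<open>unit_vec\<close> is an eigenvector of \<open>opD\<beta>\<close> for
    \<beta>, and \<open>pCons 0 p\<close> is \<beta> times \<open>p\<close>.\<close>
  moreover have "vec_of [:pCons 0 p:] j = opD\<beta> (\<lambda>j. [:p:] * pasep.unit_vec j) j"
    by (cases j) (simp_all add: vec_of_pCons vec_of_0 opD\<beta>_def pasep.opD_def pasep.opF_def
        pasep.opE_def pasep.unit_vec_def var_beta_def)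
  moreover have "vec_of (pCons p v) = (\<lambda>j. [:p:] * pasep.unit_vec j + pasep.opE (vec_of v) j)"
    by (rule ext) (rule vec_of_pCons)
  ultimately show ?case
    by (simp only: vec_of_add vec_of_smult_const vec_of_act_E IH opD\<beta>_linear opD\<beta>_opE)
qed

lemma vec_of_power: "vec_of (act_alg ((alg_const var_y * alg_D + alg_E) ^ N) 1) = (pasep.opM ^^ N) pasep.unit_vec"
proof (induction N)
  case 0
  have "vec_of 1 j = pasep.unit_vec j" for j
    by (cases j) (simp_all add: one_pCons vec_of_pCons vec_of_0 pasep.opE_def pasep.unit_vec_def)
  then show ?case
    by (simp add: act_alg_1 fun_eq_iff)
next
  case (Suc N)
  let ?v = "act_alg ((alg_const var_y * alg_D + alg_E) ^ N) 1"
  have "vec_of (smult [:var_y:] (act_D ?v) + act_E ?v) j = pasep.opM (vec_of ?v) j" for j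
    by (simp only: vec_of_add vec_of_smult_const vec_of_act_D vec_of_act_E opD\<beta>_def pasep.opM_def)
  then show ?case
    by (simp add: act_alg_times act_alg_add act_alg_const act_alg_D act_alg_E Suc fun_eq_iff)
qed

lemma vec_of_support: "v = 0 \<or> degree v < j \<Longrightarrow> vec_of v j = 0"
proof (induction v arbitrary: j)
  case (pCons p v)
  then obtain i where i: "j = Suc i"
    by (cases j) auto
  with pCons show ?case
    by (auto simp: vec_of_pCons pasep.unit_vec_def pasep.opE_def split: if_splits)
qed (simp add: vec_of_0)

text \<open>The pairing turns \<open>opE\<close> into the factor \<alpha>, so E^i contributes
  \<alpha>^i and the polynomial \<open>v\<close> itself comes back.\<close>

lemma sum_vec_of:
  assumes "\<And>j. j < B \<Longrightarrow> var_alpha * c j = q_bracket (poly_const var_q) j * c j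
      + q_bracket (poly_const var_q) (Suc j) * c (Suc j)"
    and "degree v \<le> B"
  shows "(\<Sum>j\<le>B. vec_of v j * c j) = v * c 0"
  using assms(2)
proof (induction v)
  case (pCons p v)
  have "vec_of v B = 0" "degree v \<le> B"
    using pCons.prems by (auto intro!: vec_of_support split: if_splits)
  then have "(\<Sum>j\<le>B. pasep.opE (vec_of v) j * c j) = var_alpha * (v * c 0)"
    using opE_pairing[OF assms(1), of B "vec_of v"] pCons.IH by simp
  moreover have "(\<Sum>j\<le>B. [:p:] * (pasep.unit_vec j * c j)) = [:p:] * c 0"
    by (simp add: sum.atMost_shift pasep.unit_vec_def)
  ultimately have "(\<Sum>j\<le>B. vec_of (pCons p v) j * c j) = ([:p:] + var_alpha * v) * c 0"
    by (simp only: vec_of_pCons distrib_right sum.distrib mult.assoc)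
  then show ?case
    by (simp add: var_alpha_def)
qed (simp add: vec_of_0)

lemma q_bracket_neq_0: "q_bracket (poly_const var_q) (Suc n) \<noteq> 0"
proof -
  have add: "poly_const (a + b) = poly_const a + poly_const b" for a b
    by (simp add: poly_const_def)
  have "q_bracket (poly_const var_q) m = poly_const (\<Sum>i<m. var_q ^ i)" for m
    by (induction m) (simp_all add: q_bracket_Suc add poly_const_simps, simp add: poly_const_def)
  moreover have "(\<Sum>i<m. var_q ^ i) = [:\<Sum>i<m. monom 1 i:]" for m
    by (induction m) (simp_all add: var_q_power)
  moreover have "coeff (\<Sum>i<Suc n. monom (1 :: int) i) 0 = 1"
    by (simp add: coeff_sum sum.lessThan_Suc_shift del: sum.lessThan_Suc)
  ultimately show ?thesis
    by (metis coeff_0 poly_const_def pCons_eq_0_iff zero_neq_one)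
qed

theorem theorem3p8:
  fixes N :: nat
  shows "poly_const var_y * Zbar N =
    (\<Sum>H\<in>laguerre_histories (N + 1).
       poly_const (total_weight H) * var_beta ^ (t1 H - 1) * var_alpha ^ t2 H)"
proof -
  \<comment> \<open>Large enough for \<open>transfer_identity\<close> at \<open>N\<close> and for
    \<open>sum_vec_of\<close> at \<open>Zbar N\<close>.\<close>
  define B where "B = max N (degree (Zbar N))"
  define c where "c = pairing_coeff (poly_const var_q) var_alpha B"
  have c: "var_alpha * c j = q_bracket (poly_const var_q) j * c j
      + q_bracket (poly_const var_q) (Suc j) * c (Suc j)" if "j < B" for j
    unfolding c_def using that by (rule pairing_coeff_recurrence)
  have "c 0 = (\<Prod>i=Suc 0..B. q_bracket (poly_const var_q) i)"
    by (simp add: c_def pairing_coeff_def)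
  \<comment> \<open>\<open>c 0\<close> is [B]!, a product of nonzero brackets, so it cancels at the
    end.\<close>
  then have c0: "c 0 \<noteq> 0"
    using q_bracket_neq_0 by (auto simp: Suc_le_eq gr0_conv_Suc)
  interpret laguerre_transfer "poly_const var_q" "poly_const var_y" var_beta var_alpha c B sum_no_type1 sum_type1
  proof
    show "poly_const var_q \<noteq> 0"
      by (simp add: poly_const_def var_q_def)
    show "sum_no_type1 0 h = pasep.unit_vec h" for h
      by (simp add: sum_no_type1_0 pasep.unit_vec_def)
    show "sum_type1 (Suc n) h = pasep.opM (sum_type1 n) h + poly_const var_y * pasep.opF (sum_no_type1 n) h" for n h
      by (simp add: sum_type1_Suc pasep.opM_def pasep.opD_def pasep.opF_def pasep.opE_def algebra_simps)
  qed (simp_all add: c sum_no_type1_Suc sum_type1_0)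
  have "c 0 * sum_type1 (Suc N) 0 = poly_const var_y * (\<Sum>j\<le>B. vec_of (Zbar N) j * c j)"
    using transfer_identity[of N] by (simp add: B_def Zbar_eq_act vec_of_power)
  also have "\<dots> = c 0 * (poly_const var_y * Zbar N)"
    using sum_vec_of[OF c, where v = "Zbar N"] by (simp add: B_def algebra_simps)
  finally show ?thesis
    using c0 sum_laguerre_histories[of N] by simp
qed

end
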